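(* Let $\boldsymbol{X}_1,\boldsymbol{X}_2,\ldots$ be $d$-variate random vectors with a common continuous distribution whose copula is $C$. Suppose that for each $j\in\{1,\ldots,d\}$ the copula $C$ has a continuous first-order partial derivative $\dot C_j(\boldsymbol{u})=\partial C(\boldsymbol{u})/\partial u_j$ on the set $\{\boldsymbol{u}\in[0,1]^d:0<u_j<1\}$. Suppose moreover that the empirical copula process satisfies $\mathbb{G}_n\rightsquigarrow\mathbb{G}$ in $\ell^\infty([0,1]^d)$ as $n\to\infty$, the limiting process $\mathbb{G}$ having continuous trajectories almost surely. Then, in $\ell^\infty([0,1]^d)$, the empirical beta copula process satisfies $$\mathbb{G}_n^\beta=\mathbb{G}_n+o_P(1)\rightsquigarrow\mathbb{G},\qquad n\to\infty.$$
   Context: The copula $C$ of a continuous distribution function $F$ with margins $F_1,\ldots,F_d$ is the unique distribution function on $[0,1]^d$ with uniform margins satisfying $F(x_1,\ldots,x_d)=C(F_1(x_1),\ldots,F_d(x_d))$. The vectors $\boldsymbol{X}_i$ may be i.i.d. or, more generally, form a strictly stationary sequence; only the assumed weak convergence of $\mathbb{G}_n$ is used. Ranks: $R_{i,j}^{(n)}=\sum_{k=1}^n\mathbf{1}\{X_{k,j}\le X_{i,j}\}$. Empirical copula: $\mathbb{C}_n(\boldsymbol{u})=\frac1n\sum_{i=1}^n\prod_{j=1}^d\mathbf{1}\{R_{i,j}^{(n)}/n\le u_j\}$, $\boldsymbol{u}\in[0,1]^d$. Empirical beta copula: $\mathbb{C}_n^\beta(\boldsymbol{u})=\frac1n\sum_{i=1}^n\prod_{j=1}^d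 F_{n,R_{i,j}^{(n)}}(u_j)$, where $F_{n,r}(u)=\sum_{s=r}^n\binom{n}{s}u^s(1-u)^{n-s}$. Empirical copula process: $\mathbb{G}_n=\sqrt n(\mathbb{C}_n-C)$. Empirical beta copula process: $\mathbb{G}_n^\beta=\sqrt n(\mathbb{C}_n^\beta-C)$. $\ell^\infty([0,1]^d)$ is the Banach space of bounded real functions on $[0,1]^d$ with the supremum norm; $\rightsquigarrow$ denotes weak convergence in the sense of van der Vaart and Wellner (Hoffmann-Jørgensen, with outer expectations); $o_P(1)$ denotes a process whose supremum norm converges to $0$ in probability. *)

theory Defs
  imports "HOL-Probability.Probability"
begin

section \<open>Bounded functions and weak convergence\<close>

definition bounded_funs :: "'a set \<Rightarrow> ('a \<Rightarrow> real) set" where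
  "bounded_funs S = {f \<in> extensional S. bounded (f ` S)}"

text \<open>The space of bounded real functions on \<open>S\<close> with the supremum distance. Functions on \<open>S\<close> are
  extensional; the distance is set to \<open>0\<close> outside the carrier because a metric is required to be
  nonnegative on the whole type.\<close>

definition linf :: "'a set \<Rightarrow> ('a \<Rightarrow> real) metric" where
  "linf S = metric (bounded_funs S,
     \<lambda>f g. if f \<in> bounded_funs S \<and> g \<in> bounded_funs S then (SUP x\<in>S. \<bar>f x - g x\<bar>) else 0)"

lemma bdd_above_diff_bounded_funs:
  assumes "f \<in> bounded_funs S" "g \<in> bounded_funs S"
  shows "bdd_above ((\<lambda>x. \<bar>f x - g x\<bar>) ` S)"
proof -
  obtain B1 where B1: "\<forall>x\<in>S. \<bar>f x\<bar> \<le> B1"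
    using assms(1) by (auto simp: bounded_funs_def bounded_iff)
  obtain B2 where B2: "\<forall>x\<in>S. \<bar>g x\<bar> \<le> B2"
    using assms(2) by (auto simp: bounded_funs_def bounded_iff)
  show ?thesis
    by (rule bdd_aboveI2[where M = "B1 + B2"]) (use B1 B2 in force)
qed

lemma Metric_space_linf:
  assumes "S \<noteq> {}"
  shows "Metric_space (bounded_funs S)
    (\<lambda>f g. if f \<in> bounded_funs S \<and> g \<in> bounded_funs S then (SUP x\<in>S. \<bar>f x - g x\<bar>) else 0)"
proof -
  obtain a where a: "a \<in> S" using assms by blast
  have upper: "\<bar>f x - g x\<bar> \<le> (SUP x\<in>S. \<bar>f x - g x\<bar>)"
    if "f \<in> bounded_funs S" "g \<in> bounded_funs S" "x \<in> S" for f g and x :: 'a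
    using cSUP_upper[OF that(3) bdd_above_diff_bounded_funs[OF that(1,2)]] .
  have nonneg: "0 \<le> (SUP x\<in>S. \<bar>f x - g x\<bar>)"
    if "f \<in> bounded_funs S" "g \<in> bounded_funs S" for f g :: "'a \<Rightarrow> real"
    using upper[OF that a] by linarith
  have zero: "(SUP x\<in>S. \<bar>f x - g x\<bar>) = 0 \<longleftrightarrow> f = g"
    if fg: "f \<in> bounded_funs S" "g \<in> bounded_funs S" for f g :: "'a \<Rightarrow> real"
  proof
    assume eq: "(SUP x\<in>S. \<bar>f x - g x\<bar>) = 0"
    have "f x = g x" if "x \<in> S" for x
      using upper[OF fg that] eq by simp
    then show "f = g"
      using fg by (auto simp: bounded_funs_def intro: extensionalityI)
  qed (use assms in simp)
  have triangle: "(SUP x\<in>S. \<bar>f x - h x\<bar>) \<le> (SUP x\<in>S. \<bar>f x - g x\<bar>) + (SUP x\<in>S. \<bar>g x - h x\<bar>)"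
    if "f \<in> bounded_funs S" "g \<in> bounded_funs S" "h \<in> bounded_funs S" for f g h :: "'a \<Rightarrow> real"
  proof (rule cSUP_least[OF assms])
    fix x assume "x \<in> S"
    then show "\<bar>f x - h x\<bar> \<le> (SUP x\<in>S. \<bar>f x - g x\<bar>) + (SUP x\<in>S. \<bar>g x - h x\<bar>)"
      using upper[OF that(1,2)] upper[OF that(2,3)] by (smt (verit))
  qed
  show ?thesis
    by unfold_locales (use nonneg zero triangle in \<open>auto simp: abs_minus_commute\<close>)
qed

lemma mspace_linf: "S \<noteq> {} \<Longrightarrow> mspace (linf S) = bounded_funs S"
  and mdist_linf: "S \<noteq> {} \<Longrightarrow> f \<in> bounded_funs S \<Longrightarrow> g \<in> bounded_funs S \<Longrightarrow>
    mdist (linf S) f g = (SUP x\<in>S. \<bar>f x - g x\<bar>)"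
  by (simp_all add: linf_def Metric_space_linf Metric_space.mspace_metric Metric_space.mdist_metric)

definition metric_borel :: "'a metric \<Rightarrow> 'a measure" where
  "metric_borel m = sigma (mspace m) {U. openin (mtopology_of m) U}"

text \<open>The outer expectation of a bounded, possibly non-measurable map \<open>T\<close>. For such \<open>T\<close>, restricting
  the infimum to integrable real majorants excludes only majorants that are almost surely equal to
  one of these or have infinite mean.\<close>

definition outer_expectation :: "'w measure \<Rightarrow> ('w \<Rightarrow> real) \<Rightarrow> real" where
  "outer_expectation M T =
     Inf {integral\<^sup>L M U | U. integrable M U \<and> (\<forall>\<omega>\<in>space M. T \<omega> \<le> U \<omega>)}"

text \<open>Weak convergence in the sense of Hoffmann-Jorgensen: the \<open>Z n\<close> are arbitrary maps into the
  metric space, only the limit \<open>Y\<close> (which may live on another probability space) is Borel measurable.\<close>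

definition weakly_converges ::
  "'a metric \<Rightarrow> 'w measure \<Rightarrow> (nat \<Rightarrow> 'w \<Rightarrow> 'a) \<Rightarrow> 'v measure \<Rightarrow> ('v \<Rightarrow> 'a) \<Rightarrow> bool" where
  "weakly_converges m M Z N Y \<longleftrightarrow>
     (\<forall>n. \<forall>\<omega>\<in>space M. Z n \<omega> \<in> mspace m) \<and>
     Y \<in> measurable N (metric_borel m) \<and>
     (\<forall>f. continuous_map (mtopology_of m) euclideanreal f \<and> bounded (f ` mspace m) \<longrightarrow>
        (\<lambda>n. outer_expectation M (\<lambda>\<omega>. f (Z n \<omega>))) \<longlonglongrightarrow> (LINT v|N. f (Y v)))"

text \<open>The supremum norm over \<open>S\<close> of the process \<open>Z n\<close> tends to \<open>0\<close> in (outer) probability.\<close>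

definition oP1 :: "'a set \<Rightarrow> 'w measure \<Rightarrow> (nat \<Rightarrow> 'w \<Rightarrow> 'a \<Rightarrow> real) \<Rightarrow> bool" where
  "oP1 S M Z \<longleftrightarrow> (\<forall>\<epsilon>>0.
     (\<lambda>n. outer_measure_of M {\<omega> \<in> space M. (SUP u\<in>S. \<bar>Z n \<omega> u\<bar>) > \<epsilon>}) \<longlonglongrightarrow> 0)"


section \<open>Copulas\<close>

definition unit_cube :: "(real ^ 'd) set" where
  "unit_cube = {u. \<forall>j. 0 \<le> u $ j \<and> u $ j \<le> 1}"

text \<open>The order on vectors is componentwise.\<close>

definition joint_cdf :: "(real ^ 'd) measure \<Rightarrow> real ^ 'd \<Rightarrow> real" where
  "joint_cdf \<mu> x = measure \<mu> {..x}"

definition margin :: "(real ^ 'd) measure \<Rightarrow> 'd \<Rightarrow> real measure" where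
  "margin \<mu> j = distr \<mu> borel (\<lambda>x. x $ j)"

text \<open>Only the values of a copula on the unit cube are relevant.\<close>

definition is_copula :: "(real ^ 'd \<Rightarrow> real) \<Rightarrow> bool" where
  "is_copula C \<longleftrightarrow> (\<exists>\<nu>. prob_space \<nu> \<and> sets \<nu> = sets borel \<and>
     (\<forall>j. margin \<nu> j = uniform_measure lborel {0..1}) \<and>
     (\<forall>u\<in>unit_cube. C u = joint_cdf \<nu> u))"

definition is_copula_of :: "(real ^ 'd \<Rightarrow> real) \<Rightarrow> (real ^ 'd) measure \<Rightarrow> bool" where
  "is_copula_of C \<mu> \<longleftrightarrow> is_copula C \<and>
     (\<forall>x. joint_cdf \<mu> x = C (\<chi> j. cdf (margin \<mu> j) (x $ j)))"

definition has_partial_derivative ::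
  "(real ^ 'd \<Rightarrow> real) \<Rightarrow> 'd \<Rightarrow> real \<Rightarrow> real ^ 'd \<Rightarrow> bool" where
  "has_partial_derivative C j D u \<longleftrightarrow>
     ((\<lambda>t. C (\<chi> k. if k = j then t else u $ k)) has_real_derivative D) (at (u $ j))"


section \<open>Empirical copulas\<close>

text \<open>A sample of size \<open>n\<close> consists of the points \<open>x 0, \<dots>, x (n - 1)\<close>.\<close>

definition sample_rank :: "nat \<Rightarrow> (nat \<Rightarrow> real ^ 'd) \<Rightarrow> nat \<Rightarrow> 'd \<Rightarrow> nat" where
  "sample_rank n x i j = (\<Sum>k<n. of_bool (x k $ j \<le> x i $ j))"

definition empirical_copula :: "nat \<Rightarrow> (nat \<Rightarrow> real ^ 'd) \<Rightarrow> real ^ 'd \<Rightarrow> real" where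
  "empirical_copula n x u =
     1 / real n * (\<Sum>i<n. \<Prod>j\<in>UNIV. of_bool (real (sample_rank n x i j) / real n \<le> u $ j))"

definition order_stat_cdf :: "nat \<Rightarrow> nat \<Rightarrow> real \<Rightarrow> real" where
  "order_stat_cdf n r u = (\<Sum>s=r..n. real (n choose s) * u ^ s * (1 - u) ^ (n - s))"

definition empirical_beta_copula :: "nat \<Rightarrow> (nat \<Rightarrow> real ^ 'd) \<Rightarrow> real ^ 'd \<Rightarrow> real" where
  "empirical_beta_copula n x u =
     1 / real n * (\<Sum>i<n. \<Prod>j\<in>UNIV. order_stat_cdf n (sample_rank n x i j) (u $ j))"

definition empirical_copula_process ::
  "(real ^ 'd \<Rightarrow> real) \<Rightarrow> nat \<Rightarrow> (nat \<Rightarrow> real ^ 'd) \<Rightarrow> real ^ 'd \<Rightarrow> real" where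
  "empirical_copula_process C n x = (\<lambda>u\<in>unit_cube. sqrt (real n) * (empirical_copula n x u - C u))"

definition empirical_beta_copula_process ::
  "(real ^ 'd \<Rightarrow> real) \<Rightarrow> nat \<Rightarrow> (nat \<Rightarrow> real ^ 'd) \<Rightarrow> real ^ 'd \<Rightarrow> real" where
  "empirical_beta_copula_process C n x =
     (\<lambda>u\<in>unit_cube. sqrt (real n) * (empirical_beta_copula n x u - C u))"

end

theory Submission
  imports Defs "HOL-Real_Asymp.Real_Asymp"
begin

text \<open>Since \<open>F\<^sub>n\<^sub>,\<^sub>r(u)\<close> is the probability that a binomial variable with parameters \<open>n, u\<close> is at least
  \<open>r\<close>, the empirical beta copula at \<open>u\<close> is the mean of the empirical copula at \<open>S/n\<close>, where \<open>S\<close> has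
  independent binomial coordinates with parameters \<open>n, u\<^sub>j\<close>. Hence the difference of the two
  processes at \<open>u\<close> is the mean of \<open>G\<^sub>n(S/n) - G\<^sub>n(u)\<close> plus the bias \<open>\<surd>n (E C(S/n) - C(u))\<close>.
  The first part is controlled by the modulus of continuity of \<open>G\<^sub>n\<close>, a continuous functional whose
  value at the limit is small because the limit has continuous trajectories. The bias is uniformly
  small by a first-order expansion of \<open>C\<close> in which the linear term has mean zero. Weak convergence
  then follows from Slutsky's lemma for outer expectations.\<close>

section \<open>Outer expectations and Slutsky's lemma\<close>

text \<open>The lower bound \<open>- B\<close> on \<open>T\<close> bounds the integrals of all
  majorants from below. Without such a bound the real-valued \<open>Inf\<close> need not lie below
  them.\<close>

lemma outer_expectation_le_integral:
  assumes "prob_space M" and "integrable M U" and "\<And>\<omega>. \<omega> \<in> space M \<Longrightarrow> T \<omega> \<le> U \<omega>"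
    and "\<And>\<omega>. \<omega> \<in> space M \<Longrightarrow> - B \<le> T \<omega>"
  shows "outer_expectation M T \<le> integral\<^sup>L M U"
  unfolding outer_expectation_def
proof (rule cInf_lower)
  interpret prob_space M by fact
  show "bdd_below {integral\<^sup>L M U |U. integrable M U \<and> (\<forall>\<omega>\<in>space M. T \<omega> \<le> U \<omega>)}"
  proof (rule bdd_belowI[where m = "- B"], safe)
    fix V :: "'a \<Rightarrow> real" assume "integrable M V" "\<forall>\<omega>\<in>space M. T \<omega> \<le> V \<omega>"
    with assms(4) show "- B \<le> integral\<^sup>L M V"
      by (intro integral_ge_const AE_I2) force+
  qed
qed (use assms in auto)

text \<open>The constant majorant \<open>B\<close> makes the set of integrals nonempty, so its
  infimum is approached by actual majorants.\<close>

lemma outer_expectation_integral_approx: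
  assumes "prob_space M" and "\<And>\<omega>. \<omega> \<in> space M \<Longrightarrow> T \<omega> \<le> B" and "e > 0"
  obtains U where "integrable M U" "\<And>\<omega>. \<omega> \<in> space M \<Longrightarrow> T \<omega> \<le> U \<omega>"
    "integral\<^sup>L M U < outer_expectation M T + e"
proof -
  interpret prob_space M by fact
  let ?A = "{integral\<^sup>L M U |U. integrable M U \<and> (\<forall>\<omega>\<in>space M. T \<omega> \<le> U \<omega>)}"
  have "integral\<^sup>L M (\<lambda>_. B) \<in> ?A"
    using assms by (intro CollectI exI[of _ "\<lambda>_. B"]) auto
  then have "?A \<noteq> {}" by blast
  from cInf_lessD[OF this, of "Inf ?A + e"] \<open>e > 0\<close> show thesis
    using that unfolding outer_expectation_def by fastforce
qed

text \<open>Outer expectation is sublinear rather than linear. Monotonicity, subadditivity and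
  positive homogeneity are packed into one inequality: near-optimal majorants of \<open>T1\<close>
  and \<open>T2\<close> combine to a majorant of \<open>T\<close>.\<close>

lemma outer_expectation_mono_add_scaled:
  assumes M: "prob_space M" and c: "0 \<le> c"
    and le: "\<And>\<omega>. \<omega> \<in> space M \<Longrightarrow> T \<omega> \<le> T1 \<omega> + c * T2 \<omega>"
    and T: "\<And>\<omega>. \<omega> \<in> space M \<Longrightarrow> \<bar>T \<omega>\<bar> \<le> B"
    and T1: "\<And>\<omega>. \<omega> \<in> space M \<Longrightarrow> \<bar>T1 \<omega>\<bar> \<le> B1"
    and T2: "\<And>\<omega>. \<omega> \<in> space M \<Longrightarrow> \<bar>T2 \<omega>\<bar> \<le> B2"
  shows "outer_expectation M T \<le> outer_expectation M T1 + c * outer_expectation M T2"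
proof (rule field_le_epsilon)
  fix e :: real assume e: "0 < e"
  \<comment> \<open>The error is \<open>e'\<close> from \<open>U1\<close> and \<open>c * e'\<close>
    from \<open>U2\<close>; this choice makes the total exactly \<open>e\<close>.\<close>
  define e' where "e' = e / (1 + c)"
  have "e' + c * e' = (1 + c) * e'"
    by (simp add: algebra_simps)
  then have e': "0 < e'" "e' + c * e' = e"
    using e c by (simp_all add: e'_def add_pos_nonneg)
  obtain U1 where U1: "integrable M U1" "\<And>\<omega>. \<omega> \<in> space M \<Longrightarrow> T1 \<omega> \<le> U1 \<omega>"
    "integral\<^sup>L M U1 < outer_expectation M T1 + e'"
    using outer_expectation_integral_approx[OF M _ e'(1), of T1 B1] T1 by (metis abs_le_iff)
  obtain U2 where U2: "integrable M U2" "\<And>\<omega>. \<omega> \<in> space M \<Longrightarrow> T2 \<omega> \<le> U2 \<omega>"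
    "integral\<^sup>L M U2 < outer_expectation M T2 + e'"
    using outer_expectation_integral_approx[OF M _ e'(1), of T2 B2] T2 by (metis abs_le_iff)
  have "outer_expectation M T \<le> integral\<^sup>L M (\<lambda>\<omega>. U1 \<omega> + c * U2 \<omega>)"
  proof (rule outer_expectation_le_integral[OF M])
    show "T \<omega> \<le> U1 \<omega> + c * U2 \<omega>" if "\<omega> \<in> space M" for \<omega>
      using le[OF that] U1(2)[OF that] mult_left_mono[OF U2(2)[OF that] c] by linarith
    show "- B \<le> T \<omega>" if "\<omega> \<in> space M" for \<omega>
      using T[OF that] by linarith
  qed (use U1 U2 in auto)
  also have "\<dots> = integral\<^sup>L M U1 + c * integral\<^sup>L M U2"
    using U1 U2 by simp
  also have "\<dots> \<le> (outer_expectation M T1 + e') + c * (outer_expectation M T2 + e')"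
    using U1(3) U2(3) c by (intro add_mono mult_left_mono) auto
  also have "\<dots> = outer_expectation M T1 + c * outer_expectation M T2 + e"
    using e'(2) by (simp add: algebra_simps)
  finally show "outer_expectation M T \<le> outer_expectation M T1 + c * outer_expectation M T2 + e" .
qed

lemma outer_expectation_nonneg:
  assumes M: "prob_space M" and "\<And>\<omega>. \<omega> \<in> space M \<Longrightarrow> 0 \<le> T \<omega>"
    and "\<And>\<omega>. \<omega> \<in> space M \<Longrightarrow> T \<omega> \<le> B"
  shows "0 \<le> outer_expectation M T"
proof (rule field_le_epsilon)
  fix e :: real assume "0 < e"
  then obtain U where U: "integrable M U" "\<And>\<omega>. \<omega> \<in> space M \<Longrightarrow> T \<omega> \<le> U \<omega>"
    "integral\<^sup>L M U < outer_expectation M T + e"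
    using outer_expectation_integral_approx[OF M, of T B e] assms(3) by metis
  moreover have "0 \<le> integral\<^sup>L M U"
    using U(2) assms(2) by (intro integral_nonneg_AE AE_I2) force
  ultimately show "0 \<le> outer_expectation M T + e"
    by linarith
qed

text \<open>Markov's inequality for a near-optimal majorant \<open>U\<close> of \<open>T\<close>,
  whose measurable level set contains the possibly non-measurable one of \<open>T\<close>.\<close>

lemma outer_measure_of_le_outer_expectation:
  assumes M: "prob_space M" and a: "0 < a"
    and T: "\<And>\<omega>. \<omega> \<in> space M \<Longrightarrow> 0 \<le> T \<omega>" "\<And>\<omega>. \<omega> \<in> space M \<Longrightarrow> T \<omega> \<le> B"
  shows "outer_measure_of M {\<omega> \<in> space M. a \<le> T \<omega>} \<le> ennreal (outer_expectation M T / a)"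
proof (rule ennreal_le_epsilon)
  interpret prob_space M by fact
  fix e :: real assume e: "0 < e"
  then obtain U where U: "integrable M U" "\<And>\<omega>. \<omega> \<in> space M \<Longrightarrow> T \<omega> \<le> U \<omega>"
    "integral\<^sup>L M U < outer_expectation M T + e * a"
    using outer_expectation_integral_approx[OF M, of T B "e * a"] a T(2) by (metis mult_pos_pos)
  have [measurable]: "U \<in> borel_measurable M" using U by auto
  have "outer_measure_of M {\<omega> \<in> space M. a \<le> T \<omega>} \<le> outer_measure_of M {\<omega> \<in> space M. a \<le> U \<omega>}"
    using U(2) by (intro outer_measure_of_mono) force
  also have "\<dots> = emeasure M {\<omega> \<in> space M. a \<le> U \<omega>}"
    by (rule outer_measure_of_eq) measurable
  also have "\<dots> \<le> ennreal (1 / a * integral\<^sup>L M U)"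
    using U T by (intro integral_Markov_inequality a AE_I2) force+
  also have "\<dots> \<le> ennreal (outer_expectation M T / a + e)"
    using U(3) a by (intro ennreal_leI) (simp add: field_simps)
  also have "\<dots> = ennreal (outer_expectation M T / a) + ennreal e"
    using outer_expectation_nonneg[OF M T] a e by (intro ennreal_plus) auto
  finally show "outer_measure_of M {\<omega> \<in> space M. a \<le> T \<omega>} \<le> ennreal (outer_expectation M T / a) + ennreal e" .
qed

section \<open>Lipschitz test functions and Slutsky's lemma\<close>

text \<open>The one-sided hypothesis is the form in which suprema deliver Lipschitz bounds;
  exchanging \<open>x\<close> and \<open>y\<close> yields the other side.\<close>

lemma Lipschitz_imp_continuous_map:
  fixes h :: "'a \<Rightarrow> real"
  assumes "\<And>x y. x \<in> mspace m \<Longrightarrow> y \<in> mspace m \<Longrightarrow> h x \<le> h y + L * mdist m x y"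
  shows "continuous_map (mtopology_of m) euclideanreal h"
proof -
  have "\<bar>h x - h y\<bar> \<le> L * mdist m x y" if "x \<in> mspace m" "y \<in> mspace m" for x y
    using assms[OF that] assms[OF that(2,1)] by (simp add: mdist_commute abs_le_iff)
  then have "Lipschitz_continuous_map m euclidean_metric h"
    by (auto simp: Lipschitz_continuous_map_def dist_real_def)
  from Lipschitz_continuous_imp_continuous_map[OF this] show ?thesis
    by simp
qed

lemma continuous_map_measurable_metric_borel:
  assumes "continuous_map (mtopology_of m) euclideanreal f"
  shows "f \<in> borel_measurable (metric_borel m)"
proof (rule borel_measurableI)
  fix S :: "real set" assume "open S"
  then have "openin (mtopology_of m) {x \<in> topspace (mtopology_of m). f x \<in> S}"
    using assms by (intro openin_continuous_map_preimage[where Y = euclideanreal]) auto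
  then have "openin (mtopology_of m) (f -` S \<inter> mspace m)"
    by (simp add: vimage_def Int_def conj_commute)
  moreover have "{U. openin (mtopology_of m) U} \<subseteq> Pow (mspace m)"
    using openin_subset by fastforce
  ultimately show "f -` S \<inter> space (metric_borel m) \<in> sets (metric_borel m)"
    by (auto simp: metric_borel_def space_measure_of_conv sets_measure_of)
qed

text \<open>The majorants are the sup-convolutions of \<open>f\<close> with \<open>k\<close> times the distance, which decrease to
  \<open>f\<close> pointwise as \<open>k\<close> grows.\<close>

lemma Lipschitz_majorant_approx:
  fixes f :: "'a \<Rightarrow> real"
  assumes N: "prob_space N" and Y: "Y \<in> measurable N (metric_borel m)"
    and cont: "continuous_map (mtopology_of m) euclideanreal f"
    and bdd: "\<And>x. x \<in> mspace m \<Longrightarrow> \<bar>f x\<bar> \<le> B" and c: "(LINT v|N. f (Y v)) < c"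
  obtains h L where "0 \<le> L"
    "\<And>x y. x \<in> mspace m \<Longrightarrow> y \<in> mspace m \<Longrightarrow> h x \<le> h y + L * mdist m x y"
    "\<And>x. x \<in> mspace m \<Longrightarrow> f x \<le> h x" "\<And>x. x \<in> mspace m \<Longrightarrow> \<bar>h x\<bar> \<le> B"
    "(LINT v|N. h (Y v)) < c"
proof -
  interpret prob_space N by fact
  define h where "h k x = (SUP y\<in>mspace m. f y - real k * mdist m x y)" for k :: nat and x
  have bddA: "bdd_above ((\<lambda>y. f y - real k * mdist m x y) ` mspace m)" for k x
    by (rule bdd_aboveI2[where M = B]) (use bdd in \<open>smt (verit) mdist_nonneg mult_nonneg_nonneg of_nat_0_le_iff\<close>)
  have upper: "f y - real k * mdist m x y \<le> h k x" if "y \<in> mspace m" for k x y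
    unfolding h_def by (rule cSUP_upper[OF that bddA])
  have fh: "f x \<le> h k x" if "x \<in> mspace m" for k x
  proof -
    have "mdist m x x = 0"
      by (simp add: mdist_zero[OF that that])
    then have "real k * mdist m x x = 0"
      by (rule mult_eq_0_iff[THEN iffD2, OF disjI2])
    with upper[OF that, of k x] show ?thesis by linarith
  qed
  have hB: "\<bar>h k x\<bar> \<le> B" if "x \<in> mspace m" for k x
  proof -
    have "h k x \<le> B"
      unfolding h_def
      by (rule cSUP_least) (use bdd that in \<open>auto, smt (verit) mdist_nonneg mult_nonneg_nonneg of_nat_0_le_iff\<close>)
    then show ?thesis using fh[OF that, of k] bdd[OF that] by linarith
  qed
  have lip: "h k x \<le> h k y + real k * mdist m x y" if xy: "x \<in> mspace m" "y \<in> mspace m" for k x y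
  proof -
    have "f z - real k * mdist m x z \<le> h k y + real k * mdist m x y" if z: "z \<in> mspace m" for z
    proof -
      have "mdist m y z \<le> mdist m x y + mdist m x z"
        using mdist_triangle[OF xy(2,1) z] by (simp add: mdist_commute)
      then have "real k * mdist m y z \<le> real k * mdist m x y + real k * mdist m x z"
        by (metis distrib_left mult_left_mono of_nat_0_le_iff)
      with upper[OF z, of k y] show ?thesis by linarith
    qed
    then show ?thesis
      unfolding h_def[of k x] using xy by (intro cSUP_least) auto
  qed
  have lim: "(\<lambda>k. h k x) \<longlonglongrightarrow> f x" if x: "x \<in> mspace m" for x
  proof (rule LIMSEQ_I)
    fix r :: real assume r: "0 < r"
    obtain d where d: "d > 0" "\<And>y. y \<in> mspace m \<Longrightarrow> mdist m x y < d \<Longrightarrow> \<bar>f y - f x\<bar> < r / 2"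
    proof -
      have "\<forall>U. open U \<and> f x \<in> U \<longrightarrow> (\<exists>d>0. \<forall>y. y \<in> mspace m \<and> mdist m x y < d \<longrightarrow> f y \<in> U)"
        using cont x unfolding mtopology_of_def
        by (simp add: Metric_space.continuous_map_from_metric[OF Metric_space_mspace_mdist])
      from this[rule_format, of "ball (f x) (r / 2)"] r
      have "\<exists>d>0. \<forall>y. y \<in> mspace m \<and> mdist m x y < d \<longrightarrow> f y \<in> ball (f x) (r / 2)"
        by simp
      then show thesis
        using that by (auto simp: dist_real_def abs_minus_commute)
    qed
    \<comment> \<open>For \<open>k \<ge> K\<close>, points at distance at least \<open>d\<close>
      from \<open>x\<close> are penalised by more than \<open>2 * B\<close> and cannot beat
      \<open>f x\<close>; closer points have values within \<open>r / 2\<close> of it.\<close>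
    obtain K :: nat where K: "2 * B / d < real K"
      using reals_Archimedean2 by blast
    have "norm (h k x - f x) < r" if k: "k \<ge> K" for k
    proof -
      have "f y - real k * mdist m x y \<le> f x + r / 2" if y: "y \<in> mspace m" for y
      proof (cases "mdist m x y < d")
        case True
        then show ?thesis
          using d(2)[OF y True] mult_nonneg_nonneg[OF of_nat_0_le_iff mdist_nonneg, of k m x y] by linarith
      next
        case False
        have "2 * B < real K * d"
          using K d(1) by (simp add: field_simps)
        also have "\<dots> \<le> real k * mdist m x y"
          using k False d(1) by (intro mult_mono) auto
        finally show ?thesis
          using bdd[OF x] bdd[OF y] r by linarith
      qed
      then have "h k x \<le> f x + r / 2"
        unfolding h_def using x by (intro cSUP_least) auto
      with fh[OF x, of k] r show ?thesis by simp
    qed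
    then show "\<exists>no. \<forall>n\<ge>no. norm (h n x - f x) < r" by blast
  qed
  have YS: "Y v \<in> mspace m" if "v \<in> space N" for v
    using measurable_space[OF Y that] by (simp add: metric_borel_def space_measure_of_conv)
  have "(\<lambda>k. LINT v|N. h k (Y v)) \<longlonglongrightarrow> (LINT v|N. f (Y v))"
  proof (rule integral_dominated_convergence[where w = "\<lambda>_. B"])
    show "(\<lambda>v. h k (Y v)) \<in> borel_measurable N" for k
      by (rule measurable_compose[OF Y continuous_map_measurable_metric_borel[OF Lipschitz_imp_continuous_map[OF lip]]])
    show "(\<lambda>v. f (Y v)) \<in> borel_measurable N"
      by (rule measurable_compose[OF Y continuous_map_measurable_metric_borel[OF cont]])
  qed (use YS lim hB in auto)
  then have "eventually (\<lambda>k. (LINT v|N. h k (Y v)) < c) sequentially"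
    using c by (intro order_tendstoD) auto
  then obtain k where "(LINT v|N. h k (Y v)) < c"
    by (auto dest: eventually_happens)
  then show thesis
    using that[of "real k" "h k"] lip fh hB by simp
qed

text \<open>Replacing \<open>Z\<close> by \<open>Z'\<close> changes a bounded Lipschitz
  \<open>h\<close> by at most a constant times the truncated distance. Hence the outer expectations
  of \<open>h\<close> along \<open>Z'\<close> are squeezed between those along \<open>Z\<close>, up
  to an error tending to 0.\<close>

lemma weakly_converges_Lipschitz:
  fixes h :: "'a \<Rightarrow> real"
  assumes M: "prob_space M"
    and Z: "weakly_converges m M Z N Y"
    and Z': "\<And>n \<omega>. \<omega> \<in> space M \<Longrightarrow> Z' n \<omega> \<in> mspace m"
    and close: "(\<lambda>n. outer_expectation M (\<lambda>\<omega>. min 1 (mdist m (Z' n \<omega>) (Z n \<omega>)))) \<longlonglongrightarrow> 0"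
    and lip: "\<And>x y. x \<in> mspace m \<Longrightarrow> y \<in> mspace m \<Longrightarrow> h x \<le> h y + L * mdist m x y"
    and hB: "\<And>x. x \<in> mspace m \<Longrightarrow> \<bar>h x\<bar> \<le> B" and "0 \<le> L"
  shows "(\<lambda>n. outer_expectation M (\<lambda>\<omega>. h (Z' n \<omega>))) \<longlonglongrightarrow> (LINT v|N. h (Y v))"
proof -
  let ?T = "\<lambda>n \<omega>. min 1 (mdist m (Z' n \<omega>) (Z n \<omega>))"
  \<comment> \<open>\<open>L\<close> serves distances up to 1, where the truncation is inactive;
    \<open>2 * B\<close> serves larger ones, where the truncated distance is 1.\<close>
  let ?c = "max L (2 * B)"
  have ZS: "Z n \<omega> \<in> mspace m" if "\<omega> \<in> space M" for n \<omega>
    using Z that by (auto simp: weakly_converges_def)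
  have c: "h x \<le> h y + ?c * min 1 (mdist m x y)" if xy: "x \<in> mspace m" "y \<in> mspace m" for x y
  proof (cases "mdist m x y \<le> 1")
    case True
    have "L * mdist m x y \<le> ?c * mdist m x y"
      by (intro mult_right_mono) auto
    then show ?thesis using lip[OF xy] True by (simp add: min_def)
  next
    case False
    then show ?thesis using hB[OF xy(1)] hB[OF xy(2)] by (simp add: min_def)
  qed
  have "0 \<le> ?c" using \<open>0 \<le> L\<close> by simp
  note add = outer_expectation_mono_add_scaled[OF M this, where ?B = B and ?B1.0 = B and ?B2.0 = 1]
  have T1: "\<bar>?T n \<omega>\<bar> \<le> 1" for n \<omega>
    by auto
  have 1: "outer_expectation M (\<lambda>\<omega>. h (Z' n \<omega>))
      \<le> outer_expectation M (\<lambda>\<omega>. h (Z n \<omega>)) + ?c * outer_expectation M (?T n)" for n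
    by (rule add) (use c Z' ZS hB T1 in auto)
  have 2: "outer_expectation M (\<lambda>\<omega>. h (Z n \<omega>))
      \<le> outer_expectation M (\<lambda>\<omega>. h (Z' n \<omega>)) + ?c * outer_expectation M (?T n)" for n
    by (rule add) (use c Z' ZS hB T1 in \<open>auto simp: mdist_commute\<close>)
  have "bounded (h ` mspace m)"
    using hB by (auto simp: bounded_iff)
  with Z have lim: "(\<lambda>n. outer_expectation M (\<lambda>\<omega>. h (Z n \<omega>))) \<longlonglongrightarrow> (LINT v|N. h (Y v))"
    using Lipschitz_imp_continuous_map[OF lip] by (auto simp: weakly_converges_def)
  show ?thesis
  proof (rule real_tendsto_sandwich)
    show "(\<lambda>n. outer_expectation M (\<lambda>\<omega>. h (Z n \<omega>)) - ?c * outer_expectation M (?T n)) \<longlonglongrightarrow> (LINT v|N. h (Y v))"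
      using tendsto_diff[OF lim tendsto_mult[OF tendsto_const close, of ?c]] by simp
    show "(\<lambda>n. outer_expectation M (\<lambda>\<omega>. h (Z n \<omega>)) + ?c * outer_expectation M (?T n)) \<longlonglongrightarrow> (LINT v|N. h (Y v))"
      using tendsto_add[OF lim tendsto_mult[OF tendsto_const close, of ?c]] by simp
  qed (use 1 2 in \<open>auto intro!: always_eventually simp: algebra_simps\<close>)
qed

text \<open>A bounded continuous \<open>f\<close> need not be uniformly continuous, so closeness of
  \<open>Z'\<close> and \<open>Z\<close> says nothing directly about \<open>f\<close>. Lipschitz
  functions above and below \<open>f\<close>, with integrals at the limit close to that of
  \<open>f\<close>, reduce the claim to the Lipschitz case.\<close>

theorem weakly_converges_Slutsky:
  fixes m :: "'a metric"
  assumes M: "prob_space M" and N: "prob_space N"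
    and Z: "weakly_converges m M Z N Y"
    and Z': "\<And>n \<omega>. \<omega> \<in> space M \<Longrightarrow> Z' n \<omega> \<in> mspace m"
    and close: "(\<lambda>n. outer_expectation M (\<lambda>\<omega>. min 1 (mdist m (Z' n \<omega>) (Z n \<omega>)))) \<longlonglongrightarrow> 0"
  shows "weakly_converges m M Z' N Y"
  unfolding weakly_converges_def
proof (intro conjI allI impI ballI)
  show Y: "Y \<in> measurable N (metric_borel m)"
    using Z by (simp add: weakly_converges_def)
  fix f :: "'a \<Rightarrow> real"
  assume f: "continuous_map (mtopology_of m) euclideanreal f \<and> bounded (f ` mspace m)"
  then obtain B where B: "\<And>x. x \<in> mspace m \<Longrightarrow> \<bar>f x\<bar> \<le> B"
    by (auto simp: bounded_iff)
  have mono: "outer_expectation M (\<lambda>\<omega>. g (Z' n \<omega>)) \<le> outer_expectation M (\<lambda>\<omega>. h (Z' n \<omega>))"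
    if "\<And>x. x \<in> mspace m \<Longrightarrow> g x \<le> h x" "\<And>x. x \<in> mspace m \<Longrightarrow> \<bar>g x\<bar> \<le> B"
      "\<And>x. x \<in> mspace m \<Longrightarrow> \<bar>h x\<bar> \<le> B" for g h :: "'a \<Rightarrow> real" and n
    using outer_expectation_mono_add_scaled[OF M order_refl, of "\<lambda>\<omega>. g (Z' n \<omega>)" "\<lambda>\<omega>. h (Z' n \<omega>)" "\<lambda>_. 0" B B 0]
      that Z' by simp
  show "(\<lambda>n. outer_expectation M (\<lambda>\<omega>. f (Z' n \<omega>))) \<longlonglongrightarrow> (LINT v|N. f (Y v))"
  proof (rule order_tendstoI)
    fix a assume a: "(LINT v|N. f (Y v)) < a"
    obtain h L where h: "0 \<le> L"
      "\<And>x y. x \<in> mspace m \<Longrightarrow> y \<in> mspace m \<Longrightarrow> h x \<le> h y + L * mdist m x y"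
      "\<And>x. x \<in> mspace m \<Longrightarrow> f x \<le> h x" "\<And>x. x \<in> mspace m \<Longrightarrow> \<bar>h x\<bar> \<le> B"
      "(LINT v|N. h (Y v)) < a"
      by (rule Lipschitz_majorant_approx[OF N Y conjunct1[OF f] _ a], erule B) (rule that, assumption+)
    have "eventually (\<lambda>n. outer_expectation M (\<lambda>\<omega>. h (Z' n \<omega>)) < a) sequentially"
      using weakly_converges_Lipschitz[OF M Z Z' close h(2,4,1)] h(5) by (rule order_tendstoD)
    then show "eventually (\<lambda>n. outer_expectation M (\<lambda>\<omega>. f (Z' n \<omega>)) < a) sequentially"
      by eventually_elim (use mono[OF h(3) B h(4)] in \<open>meson le_less_trans\<close>)
  next
    \<comment> \<open>Outer expectation does not commute with negation, so the upper bound for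
      \<open>- f\<close> gives no lower bound for \<open>f\<close>. Instead a majorant
      \<open>h\<close> of \<open>- f\<close> gives the Lipschitz minorant \<open>- h\<close> of
      \<open>f\<close>, whose outer expectations converge by the previous lemma.\<close>
    fix a assume "a < (LINT v|N. f (Y v))"
    then have a: "(LINT v|N. - f (Y v)) < - a"
      by simp
    have cont: "continuous_map (mtopology_of m) euclideanreal (\<lambda>x. - f x)"
      using f by (simp add: continuous_map_minus)
    have bdd: "\<bar>- f x\<bar> \<le> B" if "x \<in> mspace m" for x
      using B[OF that] by simp
    obtain h L where h: "0 \<le> L"
      "\<And>x y. x \<in> mspace m \<Longrightarrow> y \<in> mspace m \<Longrightarrow> h x \<le> h y + L * mdist m x y"
      "\<And>x. x \<in> mspace m \<Longrightarrow> - f x \<le> h x" "\<And>x. x \<in> mspace m \<Longrightarrow> \<bar>h x\<bar> \<le> B"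
      "(LINT v|N. h (Y v)) < - a"
      by (rule Lipschitz_majorant_approx[OF N Y cont _ a], erule bdd) (rule that, assumption+)
    have lip: "- h x \<le> - h y + L * mdist m x y" if "x \<in> mspace m" "y \<in> mspace m" for x y
      using h(2)[OF that(2,1)] by (simp add: mdist_commute)
    have "a < (LINT v|N. - h (Y v))"
      using h(5) by simp
    then have "eventually (\<lambda>n. a < outer_expectation M (\<lambda>\<omega>. - h (Z' n \<omega>))) sequentially"
      using weakly_converges_Lipschitz[OF M Z Z' close lip _ h(1), where B = B] h(4)
      by (intro order_tendstoD) auto
    then show "eventually (\<lambda>n. a < outer_expectation M (\<lambda>\<omega>. f (Z' n \<omega>))) sequentially"
    proof eventually_elim
      case (elim n)
      have "outer_expectation M (\<lambda>\<omega>. - h (Z' n \<omega>)) \<le> outer_expectation M (\<lambda>\<omega>. f (Z' n \<omega>))"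
        by (rule mono[OF _ _ B]) (use h(3,4) in force)+
      with elim show ?case by linarith
    qed
  qed
qed (use Z' in auto)

section \<open>Multivariate Bernstein averages\<close>

text \<open>The expectation of \<open>g (S / n)\<close> for \<open>S\<close> with independent binomial coordinates with parameters
  \<open>n\<close> and \<open>u $ j\<close>.\<close>

definition bernstein_avg :: "nat \<Rightarrow> real ^ 'd \<Rightarrow> (real ^ 'd \<Rightarrow> real) \<Rightarrow> real" where
  "bernstein_avg n u g =
     (\<Sum>s\<in>PiE UNIV (\<lambda>_. {..n}). (\<Prod>j\<in>UNIV. Bernstein n (s j) (u $ j)) * g (\<chi> j. real (s j) / real n))"

lemma bernstein_avg_mono:
  assumes u: "u \<in> unit_cube" and "\<And>w. w \<in> unit_cube \<Longrightarrow> g w \<le> h w"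
  shows "bernstein_avg n u g \<le> bernstein_avg n u h"
  unfolding bernstein_avg_def
proof (rule sum_mono)
  fix s :: "'a \<Rightarrow> nat" assume s: "s \<in> PiE UNIV (\<lambda>_. {..n})"
  then have "(\<chi> j. real (s j) / real n) \<in> unit_cube"
    by (auto simp: unit_cube_def PiE_iff divide_le_eq_1)
  moreover have "0 \<le> (\<Prod>j\<in>UNIV. Bernstein n (s j) (u $ j))"
    using u by (intro prod_nonneg ballI Bernstein_nonneg) (auto simp: unit_cube_def)
  ultimately show "(\<Prod>j\<in>UNIV. Bernstein n (s j) (u $ j)) * g (\<chi> j. real (s j) / real n)
      \<le> (\<Prod>j\<in>UNIV. Bernstein n (s j) (u $ j)) * h (\<chi> j. real (s j) / real n)"
    by (intro mult_left_mono assms)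
qed

lemma bernstein_avg_cong:
  assumes "\<And>w. g w = h w"
  shows "bernstein_avg n u g = bernstein_avg n u h"
  by (simp add: bernstein_avg_def assms)

lemma bernstein_avg_add: "bernstein_avg n u (\<lambda>w. g w + h w) = bernstein_avg n u g + bernstein_avg n u h"
  by (simp add: bernstein_avg_def distrib_left sum.distrib)

lemma bernstein_avg_diff: "bernstein_avg n u (\<lambda>w. g w - h w) = bernstein_avg n u g - bernstein_avg n u h"
  by (simp add: bernstein_avg_def right_diff_distrib sum_subtractf)

lemma bernstein_avg_cmult: "bernstein_avg n u (\<lambda>w. c * g w) = c * bernstein_avg n u g"
  by (simp add: bernstein_avg_def sum_distrib_left mult_ac)

lemma bernstein_avg_sum: "bernstein_avg n u (\<lambda>w. \<Sum>i\<in>I. g i w) = (\<Sum>i\<in>I. bernstein_avg n u (g i))"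
  unfolding bernstein_avg_def by (simp add: sum_distrib_left) (rule sum.swap)

text \<open>This is the independence of the coordinates: the sum of products over all multi-indices
  factorises.\<close>

lemma bernstein_avg_prod:
  "bernstein_avg n u (\<lambda>w. \<Prod>k\<in>UNIV. \<phi> k (w $ k)) = (\<Prod>k\<in>UNIV. \<Sum>m\<le>n. Bernstein n m (u $ k) * \<phi> k (real m / real n))"
  by (subst prod_sum_PiE) (simp_all add: bernstein_avg_def prod.distrib)

text \<open>Marginalisation: a factor 1 in every other coordinate leaves a sum of Bernstein weights,
  which is 1.\<close>

lemma bernstein_avg_coordinate:
  "bernstein_avg n u (\<lambda>w. \<phi> (w $ j)) = (\<Sum>m\<le>n. Bernstein n m (u $ j) * \<phi> (real m / real n))"
proof -
  have "bernstein_avg n u (\<lambda>w. \<phi> (w $ j)) = bernstein_avg n u (\<lambda>w. \<Prod>k\<in>UNIV. (if k = j then \<phi> else (\<lambda>_. 1)) (w $ k))"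
    by (intro bernstein_avg_cong) (simp add: if_distrib if_distribR cong: if_cong)
  also have "\<dots> = (\<Prod>k\<in>UNIV. if k = j then \<Sum>m\<le>n. Bernstein n m (u $ j) * \<phi> (real m / real n) else 1)"
    unfolding bernstein_avg_prod[where \<phi> = "\<lambda>k. if k = j then \<phi> else (\<lambda>_. 1)"]
    by (intro prod.cong) auto
  finally show ?thesis by simp
qed

lemma bernstein_avg_const: "bernstein_avg n u (\<lambda>_. c) = c"
  using bernstein_avg_coordinate[of n u "\<lambda>_. c"] by (simp flip: sum_distrib_right)

lemma bernstein_avg_abs_le:
  assumes u: "u \<in> unit_cube" and gh: "\<And>w. w \<in> unit_cube \<Longrightarrow> \<bar>g w\<bar> \<le> h w"
  shows "\<bar>bernstein_avg n u g\<bar> \<le> bernstein_avg n u h"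
proof -
  have "bernstein_avg n u g \<le> bernstein_avg n u h"
    by (rule bernstein_avg_mono[OF u]) (use gh in force)
  moreover have "bernstein_avg n u (\<lambda>w. - 1 * g w) \<le> bernstein_avg n u h"
    by (rule bernstein_avg_mono[OF u]) (use gh in force)
  ultimately show ?thesis unfolding bernstein_avg_cmult by linarith
qed

section \<open>Moments of the binomial deviations\<close>

lemma bernstein_avg_deviation:
  assumes "n > 0"
  shows "bernstein_avg n u (\<lambda>w. w $ j - u $ j) = 0"
proof -
  have "bernstein_avg n u (\<lambda>w. w $ j) = (\<Sum>m\<le>n. real m * Bernstein n m (u $ j)) / real n"
    unfolding bernstein_avg_coordinate[where \<phi> = "\<lambda>x. x"] sum_divide_distrib by (simp add: mult.commute)
  also have "\<dots> = u $ j" using assms by simp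
  finally show ?thesis by (simp add: bernstein_avg_diff bernstein_avg_const)
qed

lemma bernstein_avg_deviation_sq:
  assumes "n > 0"
  shows "bernstein_avg n u (\<lambda>w. (w $ j - u $ j)\<^sup>2) = u $ j * (1 - u $ j) / real n"
proof -
  let ?x = "u $ j"
  have "bernstein_avg n u (\<lambda>w. (w $ j - u $ j)\<^sup>2) = (\<Sum>m\<le>n. Bernstein n m ?x * (real m / real n - ?x)\<^sup>2)"
    by (rule bernstein_avg_coordinate[where \<phi> = "\<lambda>y. (y - ?x)\<^sup>2"])
  \<comment> \<open>Writing the square of \<open>m\<close> as \<open>m * (m - 1) + m\<close>
    expresses the variance through the factorial moments of the Bernstein weights.\<close>
  also have "\<dots> = (\<Sum>m\<le>n. (1 / (real n)\<^sup>2) * (real m * (real m - 1) * Bernstein n m ?x)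
      + (1 / (real n)\<^sup>2 - 2 * ?x / real n) * (real m * Bernstein n m ?x) + ?x\<^sup>2 * Bernstein n m ?x)"
    using assms by (intro sum.cong refl) (simp add: power2_eq_square field_simps)
  also have "\<dots> = (1 / (real n)\<^sup>2) * (real n * (real n - 1) * ?x\<^sup>2)
      + (1 / (real n)\<^sup>2 - 2 * ?x / real n) * (real n * ?x) + ?x\<^sup>2"
    unfolding sum.distrib sum_distrib_left[symmetric] sum_kk_Bernstein sum_k_Bernstein sum_Bernstein by simp
  also have "\<dots> = ?x * (1 - ?x) / real n"
    using assms by (simp add: power2_eq_square field_simps)
  finally show ?thesis .
qed

text \<open>The arithmetic-geometric mean inequality replaces Cauchy-Schwarz here. The parameter
  \<open>s\<close> stays free because it is later set to 1 when the variance
  \<open>u $ j * (1 - u $ j)\<close> is not small, and to a small number when it is.\<close>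

lemma bernstein_avg_abs_deviation:
  assumes u: "u \<in> unit_cube" and n: "n > 0" and s: "s > 0"
  shows "sqrt (real n) * bernstein_avg n u (\<lambda>w. \<bar>w $ j - u $ j\<bar>) \<le> (u $ j * (1 - u $ j) / s + s) / 2"
proof -
  have amgm: "sqrt (real n) * \<bar>x\<bar> \<le> real n / (2 * s) * x\<^sup>2 + s / 2" for x
  proof -
    have "0 \<le> (sqrt (real n) * \<bar>x\<bar> - s)\<^sup>2" by simp
    then have "2 * s * (sqrt (real n) * \<bar>x\<bar>) \<le> real n * x\<^sup>2 + s * s"
      by (simp add: power2_diff power_mult_distrib) (simp add: power2_eq_square algebra_simps)
    then show ?thesis using s by (simp add: field_simps)
  qed
  have "sqrt (real n) * bernstein_avg n u (\<lambda>w. \<bar>w $ j - u $ j\<bar>)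
      \<le> bernstein_avg n u (\<lambda>w. real n / (2 * s) * (w $ j - u $ j)\<^sup>2 + s / 2)"
    unfolding bernstein_avg_cmult[symmetric] by (rule bernstein_avg_mono[OF u amgm])
  also have "\<dots> = real n / (2 * s) * (u $ j * (1 - u $ j) / real n) + s / 2"
    unfolding bernstein_avg_add bernstein_avg_cmult bernstein_avg_const bernstein_avg_deviation_sq[OF n] ..
  also have "\<dots> = (u $ j * (1 - u $ j) / s + s) / 2"
    using n s by (simp add: field_simps)
  finally show ?thesis .
qed

lemma mult_one_minus_le_quarter: "x * (1 - x) \<le> (1 / 4 :: real)"
  using zero_le_power2[of "x - 1 / 2"] by (simp add: power2_eq_square algebra_simps)

lemma bernstein_avg_dist_sq_le:
  fixes u :: "real ^ 'd"
  assumes n: "n > 0"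
  shows "bernstein_avg n u (\<lambda>w. (dist w u)\<^sup>2) \<le> real CARD('d) / (4 * real n)"
proof -
  have "(dist w u)\<^sup>2 = (\<Sum>j\<in>UNIV. (w $ j - u $ j)\<^sup>2)" for w
    by (simp add: dist_norm norm_vec_def L2_set_def sum_nonneg)
  then have "bernstein_avg n u (\<lambda>w. (dist w u)\<^sup>2) = (\<Sum>j\<in>UNIV. u $ j * (1 - u $ j) / real n)"
    by (simp add: bernstein_avg_sum bernstein_avg_deviation_sq[OF n])
  also have "\<dots> \<le> (\<Sum>j\<in>(UNIV :: 'd set). (1 / 4) / real n)"
    by (intro sum_mono divide_right_mono mult_one_minus_le_quarter) auto
  finally show ?thesis by simp
qed

section \<open>The beta copula as a Bernstein average\<close>

lemma order_stat_cdf_eq_Bernstein: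
  "order_stat_cdf n r x = (\<Sum>m\<le>n. Bernstein n m x * of_bool (r \<le> m))"
proof -
  have "order_stat_cdf n r x = (\<Sum>m\<in>{..n} \<inter> {m. r \<le> m}. Bernstein n m x)"
    unfolding order_stat_cdf_def Bernstein_def by (intro sum.cong) auto
  then show ?thesis
    by (simp add: sum.inter_restrict if_distrib of_bool_def cong: if_cong)
qed

text \<open>For \<open>n > 0\<close>, comparing a rank with \<open>m\<close> is the same as
  comparing both after division by \<open>n\<close>. So each product of binomial tails is the
  average of a product of indicators, and linearity does the rest.\<close>

lemma empirical_beta_copula_eq_bernstein_avg:
  assumes "n > 0"
  shows "empirical_beta_copula n x u = bernstein_avg n u (empirical_copula n x)"
proof -
  have "empirical_beta_copula n x u
      = 1 / real n * (\<Sum>i<n. bernstein_avg n u (\<lambda>w. \<Prod>j\<in>UNIV. of_bool (real (sample_rank n x i j) / real n \<le> w $ j)))"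
    using assms
    unfolding empirical_beta_copula_def order_stat_cdf_eq_Bernstein
      bernstein_avg_prod[where \<phi> = "\<lambda>j y. of_bool (real (sample_rank n x _ j) / real n \<le> y)"]
    by (simp add: divide_le_cancel)
  also have "\<dots> = bernstein_avg n u (empirical_copula n x)"
    unfolding empirical_copula_def bernstein_avg_cmult bernstein_avg_sum ..
  finally show ?thesis .
qed

section \<open>First-order expansion of a copula\<close>

text \<open>The same vector as in \<open>has_partial_derivative\<close>, so that a partial
  derivative is the ordinary derivative of \<open>\<lambda>t. C (vec_upd u j t)\<close>.\<close>

definition vec_upd :: "real ^ 'd \<Rightarrow> 'd \<Rightarrow> real \<Rightarrow> real ^ 'd" where
  "vec_upd u j t = (\<chi> k. if k = j then t else u $ k)"

lemma vec_upd_nth [simp]: "vec_upd u j t $ k = (if k = j then t else u $ k)"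
  by (simp add: vec_upd_def)

lemma vec_upd_upd [simp]: "vec_upd (vec_upd u j s) j t = vec_upd u j t"
  by (simp add: vec_eq_iff)

lemma vec_upd_same [simp]: "vec_upd u j (u $ j) = u"
  by (simp add: vec_eq_iff)

lemma le_vec_upd: "x \<le> vec_upd u j t \<longleftrightarrow> x $ j \<le> t \<and> (\<forall>k. k \<noteq> j \<longrightarrow> x $ k \<le> u $ k)"
  by (auto simp: less_eq_vec_def)

lemma vec_upd_in_unit_cube: "u \<in> unit_cube \<Longrightarrow> 0 \<le> t \<Longrightarrow> t \<le> 1 \<Longrightarrow> vec_upd u j t \<in> unit_cube"
  by (simp add: unit_cube_def)

section \<open>Increments and partial derivatives in one coordinate\<close>

lemma copula_bounds:
  assumes "is_copula C" and "u \<in> unit_cube"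
  shows "0 \<le> C u" and "C u \<le> 1"
  using assms by (auto simp: is_copula_def joint_cdf_def prob_space.prob_le_1)

text \<open>The increment is the mass of a difference of nested orthants. That difference lies in
  the strip where coordinate \<open>j\<close> is in \<open>{s<..t}\<close>, which has mass
  \<open>t - s\<close> because the margin is uniform.\<close>

lemma copula_increment:
  assumes "is_copula C" and u: "u \<in> unit_cube" and st: "0 \<le> s" "s \<le> t" "t \<le> 1"
  shows "0 \<le> C (vec_upd u j t) - C (vec_upd u j s)" and "C (vec_upd u j t) - C (vec_upd u j s) \<le> t - s"
proof -
  obtain \<nu> where \<nu>: "prob_space \<nu>" "sets \<nu> = sets borel"
    "\<And>j. margin \<nu> j = uniform_measure lborel {0..1}" "\<And>u. u \<in> unit_cube \<Longrightarrow> C u = measure \<nu> {..u}"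
    using assms(1) by (auto simp: is_copula_def joint_cdf_def)
  interpret prob_space \<nu> by fact
  have [simp]: "space \<nu> = UNIV"
    using sets_eq_imp_space_eq[OF \<nu>(2)] by simp
  have sub: "{..vec_upd u j s} \<subseteq> {..vec_upd u j t}"
    using st by (auto simp: le_vec_upd)
  have [measurable]: "{..v} \<in> sets \<nu>" for v
    by (simp add: \<nu>(2))
  have meas: "(\<lambda>x. x $ j) \<in> measurable \<nu> borel"
    unfolding measurable_cong_sets[OF \<nu>(2) refl] by measurable
  have diff: "C (vec_upd u j t) - C (vec_upd u j s) = measure \<nu> ({..vec_upd u j t} - {..vec_upd u j s})"
    using sub u st by (simp add: \<nu>(4) vec_upd_in_unit_cube finite_measure_Diff)
  then show "0 \<le> C (vec_upd u j t) - C (vec_upd u j s)"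
    by simp
  have "measure \<nu> ({..vec_upd u j t} - {..vec_upd u j s}) \<le> measure \<nu> ((\<lambda>x. x $ j) -` {s<..t} \<inter> space \<nu>)"
    using st by (intro finite_measure_mono measurable_sets[OF meas])
      (auto simp: le_vec_upd)
  also have "\<dots> = measure (margin \<nu> j) {s<..t}"
    unfolding margin_def using meas by (simp add: measure_distr)
  also have "\<dots> = t - s"
  proof -
    have "{0..1} \<inter> {s<..t} = {s<..t}" using st by auto
    then show ?thesis using st
      by (simp add: \<nu>(3) measure_def[of "uniform_measure _ _"] emeasure_uniform_measure
          divide_ennreal[of "t - s" 1, simplified])
  qed
  finally show "C (vec_upd u j t) - C (vec_upd u j s) \<le> t - s"
    using diff by simp
qed

text \<open>By the increment bounds both \<open>C\<close> and \<open>t - C\<close> are nondecreasing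
  along coordinate \<open>j\<close>, so both have nonnegative derivatives.\<close>

lemma copula_partial_derivative_bounds:
  assumes C: "is_copula C" and u: "u \<in> unit_cube" "0 < u $ j" "u $ j < 1"
    and D: "has_partial_derivative C j D u"
  shows "0 \<le> D" and "D \<le> 1"
proof -
  have D': "((\<lambda>t. C (vec_upd u j t)) has_real_derivative D) (at (u $ j))"
    using D by (simp add: has_partial_derivative_def vec_upd_def)
  show "0 \<le> D"
    by (rule mono_on_imp_deriv_nonneg[OF _ D', of "{0..1}"])
      (use copula_increment(1)[OF C u(1)] u in \<open>force simp: mono_on_def\<close>)+
  have "((\<lambda>t. t - C (vec_upd u j t)) has_real_derivative 1 - D) (at (u $ j))"
    by (intro derivative_intros D')
  then have "0 \<le> 1 - D"
    by (rule mono_on_imp_deriv_nonneg[rotated, where A = "{0..1}"])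
      (use copula_increment(2)[OF C u(1)] u in \<open>force simp: mono_on_def algebra_simps\<close>)+
  then show "D \<le> 1" by simp
qed

lemma copula_mean_value:
  assumes C: "is_copula C"
    and D: "\<And>u. u \<in> unit_cube \<Longrightarrow> 0 < u $ j \<Longrightarrow> u $ j < 1 \<Longrightarrow> has_partial_derivative C j (C' u) u"
    and v: "v \<in> unit_cube" and b: "0 \<le> b" "b \<le> 1" "v $ j \<noteq> b"
  obtains z where "z \<in> open_segment (v $ j) b" "C (vec_upd v j b) - C v = (b - v $ j) * C' (vec_upd v j z)"
proof -
  let ?f = "\<lambda>t. C (vec_upd v j t)"
  have MV: "\<exists>z. x < z \<and> z < y \<and> ?f y - ?f x = (y - x) * C' (vec_upd v j z)"
    if xy: "0 \<le> x" "x < y" "y \<le> 1" for x y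
  proof -
    have der: "(?f has_real_derivative C' (vec_upd v j z)) (at z)" if z: "x < z" "z < y" for z
    proof -
      have "has_partial_derivative C j (C' (vec_upd v j z)) (vec_upd v j z)"
        using z xy v by (intro D vec_upd_in_unit_cube) auto
      then show ?thesis
        unfolding has_partial_derivative_def vec_upd_def[symmetric] by simp
    qed
    \<comment> \<open>The derivative is only available for coordinates strictly between 0 and 1.
      Continuity up to the end points, needed for the mean value theorem, comes from the increment
      bounds.\<close>
    have "1-lipschitz_on {x..y} ?f"
    proof (rule lipschitz_onI)
      fix s t assume st: "s \<in> {x..y}" "t \<in> {x..y}"
      show "dist (?f s) (?f t) \<le> 1 * dist s t"
        using copula_increment[OF C v, of s t j] copula_increment[OF C v, of t s j] st xy
        by (cases "s \<le> t") (auto simp: dist_real_def)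
    qed simp
    then have "continuous_on {x..y} ?f"
      by (rule lipschitz_on_continuous_on)
    from MVT[OF xy(2) this] der obtain l z where z: "x < z" "z < y" "DERIV ?f z :> l" "?f y - ?f x = (y - x) * l"
      by (metis real_differentiable_def)
    with der[OF z(1,2)] DERIV_unique[OF z(3)] show ?thesis by blast
  qed
  have v': "0 \<le> v $ j" "v $ j \<le> 1" using v by (auto simp: unit_cube_def)
  show thesis
  proof (cases "v $ j < b")
    case True
    from MV[OF v'(1) True b(2)] that True show thesis
      by (auto simp: open_segment_eq_real_ivl)
  next
    case False
    then have *: "b < v $ j" using b(3) by simp
    from MV[OF b(1) * v'(2)] obtain z where "b < z" "z < v $ j" "C v - C (vec_upd v j b) = (v $ j - b) * C' (vec_upd v j z)"
      by auto
    with that * show thesis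
      by (auto simp: open_segment_eq_real_ivl algebra_simps)
  qed
qed

text \<open>Both bounds come from the mean value theorem. In the first, the derivative and
  \<open>d\<close> both lie between 0 and 1 and so differ by at most 1; in the second, they are
  close along the whole segment.\<close>

lemma copula_coordinate_linear_approx:
  assumes C: "is_copula C"
    and D: "\<And>u. u \<in> unit_cube \<Longrightarrow> 0 < u $ j \<Longrightarrow> u $ j < 1 \<Longrightarrow> has_partial_derivative C j (C' u) u"
    and v: "v \<in> unit_cube" and b: "0 \<le> b" "b \<le> 1"
  shows "0 \<le> d \<Longrightarrow> d \<le> 1 \<Longrightarrow> \<bar>C (vec_upd v j b) - C v - d * (b - v $ j)\<bar> \<le> \<bar>b - v $ j\<bar>"
    and "(\<And>z. z \<in> open_segment (v $ j) b \<Longrightarrow> \<bar>C' (vec_upd v j z) - d\<bar> \<le> e) \<Longrightarrow>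
      \<bar>C (vec_upd v j b) - C v - d * (b - v $ j)\<bar> \<le> e * \<bar>b - v $ j\<bar>"
proof -
  have vj: "0 \<le> v $ j" "v $ j \<le> 1" using v by (auto simp: unit_cube_def)
  have *: "\<bar>C (vec_upd v j b) - C v - d * (b - v $ j)\<bar> \<le> r * \<bar>b - v $ j\<bar>"
    if "\<And>z. z \<in> open_segment (v $ j) b \<Longrightarrow> \<bar>C' (vec_upd v j z) - d\<bar> \<le> r" for r
  proof (cases "v $ j = b")
    case True
    then show ?thesis by auto
  next
    case False
    obtain z where z: "z \<in> open_segment (v $ j) b"
      "C (vec_upd v j b) - C v = (b - v $ j) * C' (vec_upd v j z)"
      using copula_mean_value[OF C D v b False] by blast
    then have "C (vec_upd v j b) - C v - d * (b - v $ j) = (C' (vec_upd v j z) - d) * (b - v $ j)"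
      by (simp add: algebra_simps)
    then show ?thesis
      using that[OF z(1)] by (simp add: abs_mult mult_right_mono)
  qed
  then show "(\<And>z. z \<in> open_segment (v $ j) b \<Longrightarrow> \<bar>C' (vec_upd v j z) - d\<bar> \<le> e) \<Longrightarrow>
      \<bar>C (vec_upd v j b) - C v - d * (b - v $ j)\<bar> \<le> e * \<bar>b - v $ j\<bar>" .
  assume d: "0 \<le> d" "d \<le> 1"
  have "\<bar>C' (vec_upd v j z) - d\<bar> \<le> 1" if "z \<in> open_segment (v $ j) b" for z
  proof -
    have z: "0 < z" "z < 1"
      using that vj b by (auto simp: open_segment_eq_real_ivl split: if_splits)
    then have w: "vec_upd v j z \<in> unit_cube" "0 < vec_upd v j z $ j" "vec_upd v j z $ j < 1"
      using v by (auto intro: vec_upd_in_unit_cube)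
    show ?thesis
      using copula_partial_derivative_bounds[OF C w D[OF w]] d by linarith
  qed
  then show "\<bar>C (vec_upd v j b) - C v - d * (b - v $ j)\<bar> \<le> \<bar>b - v $ j\<bar>"
    using *[of 1] by simp
qed

section \<open>Expansion in all coordinates and the Bernstein bias\<close>

text \<open>Keeping coordinate \<open>j\<close> at distance at least \<open>a\<close> from 0 and 1
  cuts out a compact box inside the domain of continuity.\<close>

lemma partial_derivative_uniformly_continuous:
  fixes C' :: "real ^ 'd \<Rightarrow> real"
  assumes cont: "continuous_on {u \<in> unit_cube. 0 < u $ j \<and> u $ j < 1} C'" and "0 < a" "0 < e"
  obtains r where "0 < r" "\<And>v w. v \<in> unit_cube \<Longrightarrow> w \<in> unit_cube \<Longrightarrow> a \<le> v $ j \<Longrightarrow> v $ j \<le> 1 - a \<Longrightarrow>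
    a \<le> w $ j \<Longrightarrow> w $ j \<le> 1 - a \<Longrightarrow> dist v w < r \<Longrightarrow> \<bar>C' v - C' w\<bar> \<le> e"
proof -
  let ?K = "{u :: real ^ 'd. \<forall>k. (if k = j then a else 0) \<le> u $ k \<and> u $ k \<le> (if k = j then 1 - a else 1)}"
  have K_cbox: "?K = cbox (\<chi> k. if k = j then a else 0) (\<chi> k. if k = j then 1 - a else 1)"
    by (simp add: set_eq_iff mem_box_cart)
  have "compact ?K"
    unfolding K_cbox by (rule compact_cbox)
  have K: "v \<in> ?K \<longleftrightarrow> v \<in> unit_cube \<and> a \<le> v $ j \<and> v $ j \<le> 1 - a" for v
  proof
    assume v: "v \<in> ?K"
    then have *: "(if k = j then a else 0) \<le> v $ k" "v $ k \<le> (if k = j then 1 - a else 1)" for k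
      by blast+
    have "0 \<le> v $ k \<and> v $ k \<le> 1" for k
      using *[of k] \<open>0 < a\<close> by (cases "k = j") simp_all
    then show "v \<in> unit_cube \<and> a \<le> v $ j \<and> v $ j \<le> 1 - a"
      using *[of j] by (simp add: unit_cube_def)
  qed (simp add: unit_cube_def)
  have "continuous_on ?K C'"
    by (rule continuous_on_subset[OF cont]) (use \<open>0 < a\<close> K in force)
  then have unif: "uniformly_continuous_on ?K C'"
    using \<open>compact ?K\<close> by (rule compact_uniformly_continuous)
  show thesis
  proof (rule uniformly_continuous_onE[OF unif \<open>0 < e\<close>])
    fix r :: real
    assume "0 < r" and r: "\<And>v w. v \<in> ?K \<Longrightarrow> w \<in> ?K \<Longrightarrow> dist w v < r \<Longrightarrow> dist (C' w) (C' v) < e"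
    show thesis
    proof (rule that[OF \<open>0 < r\<close>])
      fix v w :: "real ^ 'd"
      assume "v \<in> unit_cube" "w \<in> unit_cube" "a \<le> v $ j" "v $ j \<le> 1 - a" "a \<le> w $ j" "w $ j \<le> 1 - a" "dist v w < r"
      then show "\<bar>C' v - C' w\<bar> \<le> e"
        using r[of w v] unfolding K by (simp add: dist_real_def)
    qed
  qed
qed

text \<open>Coordinates with small binomial variance \<open>u\<^sub>j (1 - u\<^sub>j)\<close> need no control of the
  derivative: there the crude Lipschitz bound suffices.\<close>

lemma copula_linear_approx:
  fixes C :: "real ^ 'd \<Rightarrow> real"
  assumes C: "is_copula C"
    and D: "\<And>j u. u \<in> unit_cube \<Longrightarrow> 0 < u $ j \<Longrightarrow> u $ j < 1 \<Longrightarrow> has_partial_derivative C j (C' j u) u"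
    and cont: "\<And>j. continuous_on {u \<in> unit_cube. 0 < u $ j \<and> u $ j < 1} (C' j)"
    and e: "0 < e" and a: "0 < a"
  obtains r where "0 < r"
    "\<And>u. u \<in> unit_cube \<Longrightarrow> \<exists>d. \<forall>w\<in>unit_cube. \<bar>C w - C u - (\<Sum>j\<in>UNIV. d j * (w $ j - u $ j))\<bar>
      \<le> (\<Sum>j\<in>UNIV. (if a \<le> u $ j * (1 - u $ j) then e else 1) * \<bar>w $ j - u $ j\<bar>)
        + real CARD('d) * (dist w u)\<^sup>2 / r\<^sup>2"
proof -
  \<comment> \<open>The margin is \<open>a / 2\<close> rather than \<open>a\<close> so that points
    near \<open>u\<close> still satisfy it when \<open>u $ j\<close> lies between \<open>a\<close>
    and \<open>1 - a\<close>.\<close>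
  have "\<exists>r>0. \<forall>v w. v \<in> unit_cube \<longrightarrow> w \<in> unit_cube \<longrightarrow> a / 2 \<le> v $ j \<longrightarrow> v $ j \<le> 1 - a / 2 \<longrightarrow>
    a / 2 \<le> w $ j \<longrightarrow> w $ j \<le> 1 - a / 2 \<longrightarrow> dist v w < r \<longrightarrow> \<bar>C' j v - C' j w\<bar> \<le> e" for j
    using partial_derivative_uniformly_continuous[OF cont[of j], of "a / 2" e] a e by (smt (verit) half_gt_zero)
  then obtain \<rho> where \<rho>: "\<And>j. \<rho> j > 0" "\<And>j v w. v \<in> unit_cube \<Longrightarrow> w \<in> unit_cube \<Longrightarrow> a / 2 \<le> v $ j \<Longrightarrow>
    v $ j \<le> 1 - a / 2 \<Longrightarrow> a / 2 \<le> w $ j \<Longrightarrow> w $ j \<le> 1 - a / 2 \<Longrightarrow> dist v w < \<rho> j \<Longrightarrow> \<bar>C' j v - C' j w\<bar> \<le> e"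
    by metis
  define r where "r = min (a / 2) (Min (range \<rho>))"
  have r: "0 < r" "r \<le> a / 2" "r \<le> \<rho> j" for j
    using a \<rho>(1) by (auto simp: r_def min_le_iff_disj)
  show thesis
  proof (rule that[OF r(1)])
    fix u :: "real ^ 'd" assume u: "u \<in> unit_cube"
    have u01: "0 \<le> u $ j" "u $ j \<le> 1" for j
      using u by (auto simp: unit_cube_def)
    \<comment> \<open>Where no derivative is assumed the slope is set to 0. This is harmless: there
      \<open>u $ j * (1 - u $ j)\<close> is 0, so only the crude bound, valid for any slope between
      0 and 1, is used.\<close>
    define d where "d j = (if 0 < u $ j \<and> u $ j < 1 then C' j u else 0)" for j
    have d: "0 \<le> d j" "d j \<le> 1" for j
      using copula_partial_derivative_bounds[OF C u _ _ D[OF u]] by (auto simp: d_def)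
    show "\<exists>d. \<forall>w\<in>unit_cube. \<bar>C w - C u - (\<Sum>j\<in>UNIV. d j * (w $ j - u $ j))\<bar>
      \<le> (\<Sum>j\<in>UNIV. (if a \<le> u $ j * (1 - u $ j) then e else 1) * \<bar>w $ j - u $ j\<bar>)
        + real CARD('d) * (dist w u)\<^sup>2 / r\<^sup>2"
    proof (intro exI ballI)
      fix w :: "real ^ 'd" assume w: "w \<in> unit_cube"
      then have w01: "0 \<le> w $ j" "w $ j \<le> 1" for j
        by (auto simp: unit_cube_def)
      \<comment> \<open>The points \<open>mix A\<close> lead from \<open>u\<close> to
        \<open>w\<close> by changing one coordinate at a time, so that the increment of
        \<open>C\<close> telescopes into one-coordinate increments.\<close>
      define mix where "mix A = (\<chi> k. if k \<in> A then w $ k else u $ k)" for A :: "'d set"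
      define \<eta> where "\<eta> j = (if a \<le> u $ j * (1 - u $ j) then e else 1) * \<bar>w $ j - u $ j\<bar> + (dist w u)\<^sup>2 / r\<^sup>2" for j
      have mix_cube: "mix A \<in> unit_cube" for A
        using u01 w01 by (auto simp: mix_def unit_cube_def)
      have step: "\<bar>C (mix (insert j A)) - C (mix A) - d j * (w $ j - u $ j)\<bar> \<le> \<eta> j" if j: "j \<notin> A" for j A
      proof -
        have eq: "mix (insert j A) = vec_upd (mix A) j (w $ j)" "mix A $ j = u $ j"
          using j by (auto simp: mix_def vec_eq_iff)
        note approx = copula_coordinate_linear_approx[OF C D mix_cube[of A] w01[of j], of j "d j", unfolded eq(2)]
        have bound1: "\<bar>C (mix (insert j A)) - C (mix A) - d j * (w $ j - u $ j)\<bar> \<le> \<bar>w $ j - u $ j\<bar>"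
          unfolding eq(1) using approx(1) d by blast
        \<comment> \<open>If \<open>w\<close> is far from \<open>u\<close>, the quadratic term of
          \<open>\<eta>\<close> alone exceeds the crude bound; if the variance is small, the weight
          1 absorbs it. Only the third case needs continuity of the derivative.\<close>
        consider "dist w u \<ge> r" | "\<not> a \<le> u $ j * (1 - u $ j)" | "dist w u < r" "a \<le> u $ j * (1 - u $ j)"
          by linarith
        then show ?thesis
        proof cases
          case 1
          have "1 \<le> (dist w u)\<^sup>2 / r\<^sup>2"
            using 1 r(1) by (simp add: power_mono)
          moreover have "\<bar>w $ j - u $ j\<bar> \<le> 1"
            using u01[of j] w01[of j] by linarith
          moreover have "0 \<le> (if a \<le> u $ j * (1 - u $ j) then e else 1) * \<bar>w $ j - u $ j\<bar>"
            using e by simp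
          ultimately show ?thesis
            using bound1 unfolding \<eta>_def by linarith
        next
          case 2
          then show ?thesis using bound1 by (simp add: \<eta>_def add_increasing2)
        next
          case 3
          have "u $ j * (1 - u $ j) \<le> u $ j" "u $ j * (1 - u $ j) \<le> 1 - u $ j"
            using u01[of j] by (auto intro: mult_left_le mult_left_le_one_le)
          then have uj: "a \<le> u $ j" "u $ j \<le> 1 - a"
            using 3(2) by linarith+
          have "\<bar>C' j (vec_upd (mix A) j z) - d j\<bar> \<le> e" if z: "z \<in> open_segment (u $ j) (w $ j)" for z
          proof -
            let ?v = "vec_upd (mix A) j z"
            have zu: "\<bar>z - u $ j\<bar> \<le> \<bar>w $ j - u $ j\<bar>" and z01: "0 \<le> z" "z \<le> 1"
              using z u01[of j] w01[of j] by (auto simp: open_segment_eq_real_ivl split: if_splits)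
            \<comment> \<open>Every coordinate of \<open>?v\<close> lies between those of
              \<open>u\<close> and \<open>w\<close>, so \<open>?v\<close> is no farther from
              \<open>u\<close> than \<open>w\<close> is.\<close>
            have "norm (?v - u) \<le> norm (w - u)"
              using zu by (intro norm_le_componentwise_cart) (auto simp: mix_def)
            then have near: "dist ?v u < r"
              using 3(1) by (simp add: dist_norm)
            have "\<bar>w $ j - u $ j\<bar> < a / 2"
              using component_le_norm_cart[of "w - u" j] 3(1) r(2) by (simp add: dist_norm)
            with zu have "\<bar>z - u $ j\<bar> < a / 2" by linarith
            then have "a / 2 \<le> z" "z \<le> 1 - a / 2"
              using uj a by linarith+
            then have "\<bar>C' j ?v - C' j u\<bar> \<le> e"
              using uj near a r(3)[of j]
              by (intro \<rho>(2) vec_upd_in_unit_cube mix_cube u z01) auto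
            then show ?thesis
              using uj a by (simp add: d_def)
          qed
          then have "\<bar>C (mix (insert j A)) - C (mix A) - d j * (w $ j - u $ j)\<bar> \<le> e * \<bar>w $ j - u $ j\<bar>"
            unfolding eq(1) using approx(2) by blast
          then show ?thesis
            using 3(2) by (simp add: \<eta>_def add_increasing2)
        qed
      qed
      have "\<bar>C (mix A) - C u - (\<Sum>j\<in>A. d j * (w $ j - u $ j))\<bar> \<le> (\<Sum>j\<in>A. \<eta> j)" if "finite A" for A
        using that
      proof induction
        case empty
        then show ?case by (simp add: mix_def)
      next
        case (insert j A)
        then show ?case using step[OF insert(2)] by simp
      qed
      from this[of UNIV] show "\<bar>C w - C u - (\<Sum>j\<in>UNIV. d j * (w $ j - u $ j))\<bar>
        \<le> (\<Sum>j\<in>UNIV. (if a \<le> u $ j * (1 - u $ j) then e else 1) * \<bar>w $ j - u $ j\<bar>)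
          + real CARD('d) * (dist w u)\<^sup>2 / r\<^sup>2"
        by (simp add: mix_def \<eta>_def sum.distrib)
    qed
  qed
qed

text \<open>The linear term averages to 0. After scaling by \<open>sqrt (real n)\<close>, the
  absolute deviations stay bounded but carry a small weight or a small variance, and the quadratic
  term is of order \<open>1 / sqrt (real n)\<close>.\<close>

lemma copula_bernstein_bias:
  fixes C :: "real ^ 'd \<Rightarrow> real"
  assumes C: "is_copula C"
    and D: "\<And>j u. u \<in> unit_cube \<Longrightarrow> 0 < u $ j \<Longrightarrow> u $ j < 1 \<Longrightarrow> has_partial_derivative C j (C' j u) u"
    and cont: "\<And>j. continuous_on {u \<in> unit_cube. 0 < u $ j \<and> u $ j < 1} (C' j)"
    and e: "0 < e"
  shows "eventually (\<lambda>n. \<forall>u\<in>unit_cube. \<bar>sqrt (real n) * (bernstein_avg n u C - C u)\<bar> \<le> e) sequentially"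
proof -
  \<comment> \<open>Each of the \<open>CARD('d)\<close> coordinates may contribute
    \<open>\<epsilon>\<close>, for a total of \<open>e / 2\<close>; the other half is left for the
    quadratic term. The variance threshold is the square of \<open>\<epsilon>\<close>, so a standard
    deviation below \<open>\<epsilon>\<close> counts as small.\<close>
  define \<epsilon> where "\<epsilon> = e / (2 * real CARD('d))"
  have \<epsilon>: "0 < \<epsilon>" "real CARD('d) * \<epsilon> = e / 2"
    using e by (simp_all add: \<epsilon>_def)
  obtain r where r: "0 < r" and approx:
    "\<And>u. u \<in> unit_cube \<Longrightarrow> \<exists>d. \<forall>w\<in>unit_cube. \<bar>C w - C u - (\<Sum>j\<in>UNIV. d j * (w $ j - u $ j))\<bar>
      \<le> (\<Sum>j\<in>UNIV. (if \<epsilon>\<^sup>2 \<le> u $ j * (1 - u $ j) then \<epsilon> else 1) * \<bar>w $ j - u $ j\<bar>)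
        + real CARD('d) * (dist w u)\<^sup>2 / r\<^sup>2"
    using copula_linear_approx[OF C D cont \<epsilon>(1) zero_less_power[OF \<epsilon>(1), of 2]] by blast
  let ?c = "real CARD('d) / r\<^sup>2"
  have bound: "\<bar>sqrt (real n) * (bernstein_avg n u C - C u)\<bar> \<le> e / 2 + ?c * real CARD('d) / 4 * (1 / sqrt (real n))"
    if u: "u \<in> unit_cube" and n: "n > 0" for n u
  proof -
    let ?\<eta> = "\<lambda>j. if \<epsilon>\<^sup>2 \<le> u $ j * (1 - u $ j) then \<epsilon> else 1"
    obtain d where d: "\<And>w. w \<in> unit_cube \<Longrightarrow> \<bar>C w - C u - (\<Sum>j\<in>UNIV. d j * (w $ j - u $ j))\<bar>
      \<le> (\<Sum>j\<in>UNIV. ?\<eta> j * \<bar>w $ j - u $ j\<bar>) + ?c * (dist w u)\<^sup>2"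
      using approx[OF u] by auto
    have "bernstein_avg n u C - C u = bernstein_avg n u (\<lambda>w. C w - C u - (\<Sum>j\<in>UNIV. d j * (w $ j - u $ j)))"
      by (simp only: bernstein_avg_diff[of _ _ "\<lambda>w. C w - C u"] bernstein_avg_diff[of _ _ C] bernstein_avg_const
          bernstein_avg_sum bernstein_avg_cmult bernstein_avg_deviation[OF n]) simp
    also have "\<bar>\<dots>\<bar> \<le> bernstein_avg n u (\<lambda>w. (\<Sum>j\<in>UNIV. ?\<eta> j * \<bar>w $ j - u $ j\<bar>) + ?c * (dist w u)\<^sup>2)"
      by (rule bernstein_avg_abs_le[OF u d])
    also have "\<dots> = (\<Sum>j\<in>UNIV. ?\<eta> j * bernstein_avg n u (\<lambda>w. \<bar>w $ j - u $ j\<bar>)) + ?c * bernstein_avg n u (\<lambda>w. (dist w u)\<^sup>2)"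
      by (simp only: bernstein_avg_add bernstein_avg_sum bernstein_avg_cmult)
    finally have "\<bar>sqrt (real n) * (bernstein_avg n u C - C u)\<bar>
      \<le> sqrt (real n) * ((\<Sum>j\<in>UNIV. ?\<eta> j * bernstein_avg n u (\<lambda>w. \<bar>w $ j - u $ j\<bar>)) + ?c * bernstein_avg n u (\<lambda>w. (dist w u)\<^sup>2))"
      by (simp only: abs_mult abs_of_nonneg real_sqrt_ge_zero of_nat_0_le_iff mult_left_mono)
    also have "\<dots> = (\<Sum>j\<in>UNIV. ?\<eta> j * (sqrt (real n) * bernstein_avg n u (\<lambda>w. \<bar>w $ j - u $ j\<bar>)))
        + ?c * (sqrt (real n) * bernstein_avg n u (\<lambda>w. (dist w u)\<^sup>2))"
      by (simp only: distrib_left sum_distrib_left mult.left_commute)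
    also have "\<dots> \<le> (\<Sum>j\<in>(UNIV :: 'd set). \<epsilon>) + ?c * (sqrt (real n) * (real CARD('d) / (4 * real n)))"
    proof (intro add_mono sum_mono mult_left_mono bernstein_avg_dist_sq_le n)
      fix j
      define v where "v = u $ j * (1 - u $ j)"
      note dev = bernstein_avg_abs_deviation[OF u n, of _ j, folded v_def]
      show "(if \<epsilon>\<^sup>2 \<le> u $ j * (1 - u $ j) then \<epsilon> else 1) * (sqrt (real n) * bernstein_avg n u (\<lambda>w. \<bar>w $ j - u $ j\<bar>)) \<le> \<epsilon>"
      \<comment> \<open>Large variance: \<open>s = 1\<close> bounds the scaled deviation by 1, and
        the weight is \<open>\<epsilon>\<close>. Small variance: the weight is 1, and
        \<open>s = \<epsilon>\<close> bounds the scaled deviation by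
        \<open>\<epsilon>\<close>.\<close>
      proof (cases "\<epsilon>\<^sup>2 \<le> v")
        case True
        have "sqrt (real n) * bernstein_avg n u (\<lambda>w. \<bar>w $ j - u $ j\<bar>) \<le> 1"
          by (rule order_trans[OF dev[OF zero_less_one]])
            (use mult_one_minus_le_quarter[of "u $ j", folded v_def] in simp)
        then show ?thesis using True \<epsilon>(1) by (simp add: v_def mult_left_le)
      next
        case False
        then have "v / \<epsilon> \<le> \<epsilon>"
          using \<epsilon>(1) by (simp add: divide_le_eq power2_eq_square)
        then have "(v / \<epsilon> + \<epsilon>) / 2 \<le> \<epsilon>"
          by simp
        from order_trans[OF dev[OF \<epsilon>(1)] this] show ?thesis
          using False by (simp add: v_def)
      qed
    qed auto
    also have "sqrt (real n) * (real CARD('d) / (4 * real n)) = real CARD('d) / 4 * (1 / sqrt (real n))"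
      using n by (simp add: field_simps)
    finally show ?thesis
      using \<epsilon>(2) by simp
  qed
  have "(\<lambda>n. ?c * real CARD('d) / 4 * (1 / sqrt (real n))) \<longlonglongrightarrow> 0"
    by (rule tendsto_mult_right_zero) real_asymp
  then have "eventually (\<lambda>n. ?c * real CARD('d) / 4 * (1 / sqrt (real n)) < e / 2) sequentially"
    using e by (intro order_tendstoD) auto
  then show ?thesis
    using eventually_gt_at_top[of 0]
  proof eventually_elim
    case (elim n)
    show ?case
    proof
      fix u :: "real ^ 'd" assume "u \<in> unit_cube"
      from bound[OF this elim(2)] elim(1) show "\<bar>sqrt (real n) * (bernstein_avg n u C - C u)\<bar> \<le> e"
        by linarith
    qed
  qed
qed

section \<open>Empirical copula processes\<close>

lemma unit_cube_eq_cbox: "unit_cube = cbox (0 :: real ^ 'd) 1"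
  by (auto simp: unit_cube_def mem_box_cart)

lemma zero_in_unit_cube: "0 \<in> unit_cube"
  by (simp add: unit_cube_def)

lemma unit_cube_nonempty: "unit_cube \<noteq> {}"
  using zero_in_unit_cube by blast

lemma bounded_funs_diff_le_mdist:
  assumes "f \<in> bounded_funs S" "g \<in> bounded_funs S" "x \<in> S"
  shows "\<bar>f x - g x\<bar> \<le> mdist (linf S) f g"
  using assms cSUP_upper[OF assms(3) bdd_above_diff_bounded_funs[OF assms(1,2)]]
  by (subst mdist_linf) auto

section \<open>Modulus of continuity on the unit cube\<close>

definition cube_modulus :: "real \<Rightarrow> (real ^ 'd \<Rightarrow> real) \<Rightarrow> real" where
  "cube_modulus \<delta> g =
     (SUP (u, v)\<in>{(u, v). u \<in> unit_cube \<and> v \<in> unit_cube \<and> dist u v \<le> \<delta>}. \<bar>g u - g v\<bar>)"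

lemma cube_modulus_least:
  assumes "0 \<le> \<delta>"
    and "\<And>u v. u \<in> unit_cube \<Longrightarrow> v \<in> unit_cube \<Longrightarrow> dist u v \<le> \<delta> \<Longrightarrow> \<bar>g u - g v\<bar> \<le> B"
  shows "cube_modulus \<delta> g \<le> B"
  unfolding cube_modulus_def
proof (rule cSUP_least)
  show "{(u, v). u \<in> unit_cube \<and> v \<in> unit_cube \<and> dist u v \<le> \<delta>} \<noteq> ({} :: ((real ^ 'a) \<times> (real ^ 'a)) set)"
    using zero_in_unit_cube assms(1) by (auto intro!: exI[of _ 0])
qed (use assms(2) in auto)

lemma cube_modulus_upper:
  assumes "g \<in> bounded_funs unit_cube" "u \<in> unit_cube" "v \<in> unit_cube" "dist u v \<le> \<delta>"
  shows "\<bar>g u - g v\<bar> \<le> cube_modulus \<delta> g"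
proof -
  obtain B where B: "\<And>x. x \<in> unit_cube \<Longrightarrow> \<bar>g x\<bar> \<le> B"
    using assms(1) by (auto simp: bounded_funs_def bounded_iff)
  have diff: "\<bar>g x - g y\<bar> \<le> 2 * B" if "x \<in> unit_cube" "y \<in> unit_cube" for x y
    using B[OF that(1)] B[OF that(2)] by linarith
  have "bdd_above ((\<lambda>(u, v). \<bar>g u - g v\<bar>) ` {(u, v). u \<in> unit_cube \<and> v \<in> unit_cube \<and> dist u v \<le> \<delta>})"
    by (rule bdd_aboveI2[where M = "2 * B"]) (auto intro: diff)
  from cSUP_upper[OF _ this, of "(u, v)"] assms(2-4) show ?thesis
    by (simp add: cube_modulus_def)
qed

lemma cube_modulus_nonneg:
  assumes "g \<in> bounded_funs unit_cube" "0 \<le> \<delta>"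
  shows "0 \<le> cube_modulus \<delta> g"
  using cube_modulus_upper[OF assms(1) zero_in_unit_cube zero_in_unit_cube, of \<delta>] assms(2) by simp

text \<open>Each of the two evaluation points costs one distance, hence the factor 2. The modulus is
  thus a continuous functional on \<open>linf unit_cube\<close>, usable as a test function once
  truncated.\<close>

lemma cube_modulus_Lipschitz:
  assumes "f \<in> bounded_funs unit_cube" "g \<in> bounded_funs unit_cube" "0 \<le> \<delta>"
  shows "cube_modulus \<delta> f \<le> cube_modulus \<delta> g + 2 * mdist (linf unit_cube) f g"
proof (rule cube_modulus_least[OF assms(3)])
  fix u v :: "real ^ 'a" assume uv: "u \<in> unit_cube" "v \<in> unit_cube" "dist u v \<le> \<delta>"
  show "\<bar>f u - f v\<bar> \<le> cube_modulus \<delta> g + 2 * mdist (linf unit_cube) f g"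
    using cube_modulus_upper[OF assms(2) uv] bounded_funs_diff_le_mdist[OF assms(1,2) uv(1)]
      bounded_funs_diff_le_mdist[OF assms(1,2) uv(2)] by linarith
qed

lemma cube_modulus_tendsto_0:
  assumes "g \<in> bounded_funs unit_cube" and "continuous_on unit_cube g"
  shows "(\<lambda>k. cube_modulus (1 / real (Suc k)) g) \<longlonglongrightarrow> 0"
proof (rule LIMSEQ_I)
  fix e :: real assume e: "0 < e"
  have unif: "uniformly_continuous_on unit_cube g"
    using assms(2) by (rule compact_uniformly_continuous) (simp add: unit_cube_eq_cbox compact_cbox)
  show "\<exists>no. \<forall>k\<ge>no. norm (cube_modulus (1 / real (Suc k)) g - 0) < e"
  proof (rule uniformly_continuous_onE[OF unif half_gt_zero[OF e]])
    fix d :: real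
    assume d: "0 < d" "\<And>u v. u \<in> unit_cube \<Longrightarrow> v \<in> unit_cube \<Longrightarrow> dist v u < d \<Longrightarrow> dist (g v) (g u) < e / 2"
    obtain K where K: "1 / real (Suc K) < d"
      using d(1) by (metis nat_approx_posE)
    have "norm (cube_modulus (1 / real (Suc k)) g - 0) < e" if "k \<ge> K" for k
    proof -
      have "1 / real (Suc k) \<le> 1 / real (Suc K)"
        using that by (simp add: frac_le)
      then have "cube_modulus (1 / real (Suc k)) g \<le> e / 2"
        using d(2) K by (intro cube_modulus_least) (force simp: dist_real_def)+
      then show ?thesis
        using cube_modulus_nonneg[OF assms(1), of "1 / real (Suc k)"] e by simp
    qed
    then show ?thesis by blast
  qed
qed

section \<open>The two empirical processes and the distance between them\<close>

lemma empirical_copula_bounds: "0 \<le> empirical_copula n x u" "empirical_copula n x u \<le> 1"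
proof -
  have "(\<Sum>i<n. \<Prod>j\<in>UNIV. of_bool (real (sample_rank n x i j) / real n \<le> u $ j)) \<le> (\<Sum>i<n. 1 :: real)"
    by (intro sum_mono prod_le_1) auto
  then show "empirical_copula n x u \<le> 1"
    by (cases "n = 0") (simp_all add: empirical_copula_def divide_le_eq)
qed (auto simp: empirical_copula_def intro!: divide_nonneg_nonneg sum_nonneg prod_nonneg)

lemma empirical_beta_copula_bounds:
  assumes "u \<in> unit_cube"
  shows "0 \<le> empirical_beta_copula n x u" "empirical_beta_copula n x u \<le> 1"
proof -
  have "0 \<le> empirical_beta_copula n x u \<and> empirical_beta_copula n x u \<le> 1"
  proof (cases "n = 0")
    case False
    then show ?thesis
      using bernstein_avg_mono[OF assms, of "\<lambda>_. 0" "empirical_copula n x" n]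
        bernstein_avg_mono[OF assms, of "empirical_copula n x" "\<lambda>_. 1" n]
      by (simp add: empirical_beta_copula_eq_bernstein_avg empirical_copula_bounds bernstein_avg_const)
  qed (simp add: empirical_beta_copula_def)
  then show "0 \<le> empirical_beta_copula n x u" "empirical_beta_copula n x u \<le> 1"
    by auto
qed

lemma scaled_diff_in_bounded_funs:
  fixes C E :: "real ^ 'd \<Rightarrow> real"
  assumes "is_copula C" and "\<And>u. u \<in> unit_cube \<Longrightarrow> 0 \<le> E u \<and> E u \<le> 1"
  shows "(\<lambda>u\<in>unit_cube. sqrt (real n) * (E u - C u)) \<in> bounded_funs unit_cube"
proof -
  have "\<bar>E u - C u\<bar> \<le> 1" if "u \<in> unit_cube" for u
    using copula_bounds[OF assms(1) that] assms(2)[OF that] by linarith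
  then have "\<bar>sqrt (real n) * (E u - C u)\<bar> \<le> sqrt (real n)" if "u \<in> unit_cube" for u
    using that by (simp add: abs_mult mult_left_le)
  then show ?thesis
    by (auto simp: bounded_funs_def bounded_iff intro!: exI[of _ "sqrt (real n)"])
qed

lemma empirical_copula_process_in_bounded_funs:
  "is_copula C \<Longrightarrow> empirical_copula_process C n x \<in> bounded_funs unit_cube"
  unfolding empirical_copula_process_def
  by (rule scaled_diff_in_bounded_funs) (auto simp: empirical_copula_bounds)

lemma empirical_beta_copula_process_in_bounded_funs:
  "is_copula C \<Longrightarrow> empirical_beta_copula_process C n x \<in> bounded_funs unit_cube"
  unfolding empirical_beta_copula_process_def
  by (rule scaled_diff_in_bounded_funs) (auto simp: empirical_beta_copula_bounds)

text \<open>Averaging the increments of the process about \<open>u\<close>, near points cost the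
  modulus. Far points have increments of size at most \<open>2 * sqrt (real n)\<close>, and a
  Chebyshev bound on their weight leaves order \<open>1 / sqrt (real n)\<close>. The bias of
  \<open>C\<close> is added on top.\<close>

lemma empirical_beta_copula_process_diff:
  fixes C :: "real ^ 'd \<Rightarrow> real"
  assumes C: "is_copula C" and n: "n > 0" and \<delta>: "0 < \<delta>"
    and bias: "\<And>u. u \<in> unit_cube \<Longrightarrow> \<bar>sqrt (real n) * (bernstein_avg n u C - C u)\<bar> \<le> b"
  shows "mdist (linf unit_cube) (empirical_beta_copula_process C n x) (empirical_copula_process C n x)
    \<le> cube_modulus \<delta> (empirical_copula_process C n x) + real CARD('d) / (2 * \<delta>\<^sup>2) * (1 / sqrt (real n)) + b"
proof -
  let ?G = "empirical_copula_process C n x"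
  \<comment> \<open>\<open>H\<close> drops the restriction to the cube, so its Bernstein average
    splits by linearity.\<close>
  define H where "H w = sqrt (real n) * (empirical_copula n x w - C w)" for w
  have G: "?G \<in> bounded_funs unit_cube"
    by (rule empirical_copula_process_in_bounded_funs[OF C])
  have GH: "?G w = H w" if "w \<in> unit_cube" for w
    using that by (simp add: empirical_copula_process_def H_def)
  have HB: "\<bar>H w\<bar> \<le> sqrt (real n)" if "w \<in> unit_cube" for w
  proof -
    have "\<bar>empirical_copula n x w - C w\<bar> \<le> 1"
      using copula_bounds[OF C that] empirical_copula_bounds[of n x w] by linarith
    then show ?thesis by (simp add: H_def abs_mult mult_left_le)
  qed
  have "\<bar>empirical_beta_copula_process C n x u - ?G u\<bar>
      \<le> cube_modulus \<delta> ?G + real CARD('d) / (2 * \<delta>\<^sup>2) * (1 / sqrt (real n)) + b" if u: "u \<in> unit_cube" for u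
  proof -
    have m: "0 \<le> cube_modulus \<delta> ?G"
      using cube_modulus_nonneg[OF G] \<delta> by simp
    have HH: "\<bar>H w - H u\<bar> \<le> cube_modulus \<delta> ?G + 2 * sqrt (real n) / \<delta>\<^sup>2 * (dist w u)\<^sup>2" if w: "w \<in> unit_cube" for w
    proof (cases "dist w u \<le> \<delta>")
      case True
      show ?thesis
        using cube_modulus_upper[OF G w u True] \<delta> by (simp add: GH u w add_increasing2)
    next
      case False
      then have "1 \<le> (dist w u)\<^sup>2 / \<delta>\<^sup>2"
        using \<delta> by (simp add: power_mono)
      then have "2 * sqrt (real n) * 1 \<le> 2 * sqrt (real n) * ((dist w u)\<^sup>2 / \<delta>\<^sup>2)"
        by (intro mult_left_mono) auto
      then show ?thesis
        using HB[OF u] HB[OF w] m by simp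
    qed
    have "bernstein_avg n u (\<lambda>w. H w - H u)
        = sqrt (real n) * (empirical_beta_copula n x u - bernstein_avg n u C) - H u"
      by (simp add: H_def bernstein_avg_diff bernstein_avg_cmult bernstein_avg_const
          empirical_beta_copula_eq_bernstein_avg[OF n])
    then have "empirical_beta_copula_process C n x u - ?G u
      = bernstein_avg n u (\<lambda>w. H w - H u) + sqrt (real n) * (bernstein_avg n u C - C u)"
      using u by (simp add: GH empirical_beta_copula_process_def algebra_simps)
    also have "\<bar>\<dots>\<bar> \<le> bernstein_avg n u (\<lambda>w. cube_modulus \<delta> ?G + 2 * sqrt (real n) / \<delta>\<^sup>2 * (dist w u)\<^sup>2) + b"
      using bernstein_avg_abs_le[OF u HH] bias[OF u]
      by (intro order_trans[OF abs_triangle_ineq] add_mono)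
    also have "\<dots> \<le> cube_modulus \<delta> ?G + 2 * sqrt (real n) / \<delta>\<^sup>2 * (real CARD('d) / (4 * real n)) + b"
      unfolding bernstein_avg_add bernstein_avg_const bernstein_avg_cmult
      by (intro add_mono order_refl mult_left_mono bernstein_avg_dist_sq_le n) simp
    also have "2 * sqrt (real n) / \<delta>\<^sup>2 * (real CARD('d) / (4 * real n)) = real CARD('d) / (2 * \<delta>\<^sup>2) * (1 / sqrt (real n))"
      using n \<delta> by (simp add: field_simps)
    finally show ?thesis .
  qed
  then show ?thesis
    by (subst mdist_linf[OF unit_cube_nonempty empirical_beta_copula_process_in_bounded_funs[OF C] G])
      (rule cSUP_least[OF unit_cube_nonempty])
qed

section \<open>Asymptotic equivalence of the two processes\<close>

text \<open>The truncated modulus is a bounded continuous functional, so weak convergence carries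
  its outer expectation to its integral at \<open>G\<close>. By dominated convergence that integral
  is small for some \<open>\<delta>\<close>, since almost every trajectory is uniformly
  continuous.\<close>

lemma weakly_converges_cube_modulus_small:
  fixes G :: "'v \<Rightarrow> real ^ 'd \<Rightarrow> real"
  assumes N: "prob_space N" and Z: "weakly_converges (linf unit_cube) M Z N G"
    and cont: "AE v in N. continuous_on unit_cube (G v)" and e: "0 < e"
  obtains \<delta> where "0 < \<delta>"
    "eventually (\<lambda>n. outer_expectation M (\<lambda>\<omega>. min 1 (cube_modulus \<delta> (Z n \<omega>))) < e) sequentially"
proof -
  interpret prob_space N by fact
  let ?m = "linf (unit_cube :: (real ^ 'd) set)"
  let ?h = "\<lambda>k g. min 1 (cube_modulus (1 / real (Suc k)) g)"
  have ms: "mspace ?m = bounded_funs unit_cube"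
    by (rule mspace_linf[OF unit_cube_nonempty])
  have G: "G \<in> measurable N (metric_borel ?m)"
    using Z by (simp add: weakly_converges_def)
  have GS: "G v \<in> bounded_funs unit_cube" if "v \<in> space N" for v
    using measurable_space[OF G that] by (simp add: metric_borel_def space_measure_of_conv ms)
  have h01: "0 \<le> ?h k g" "?h k g \<le> 1" if "g \<in> bounded_funs unit_cube" for k g
    using cube_modulus_nonneg[OF that, of "1 / real (Suc k)"] by auto
  have cont_h: "continuous_map (mtopology_of ?m) euclideanreal (?h k)" for k
  proof (rule Lipschitz_imp_continuous_map[where L = 2])
    fix f g assume fg: "f \<in> mspace ?m" "g \<in> mspace ?m"
    then have "cube_modulus (1 / real (Suc k)) f \<le> cube_modulus (1 / real (Suc k)) g + 2 * mdist ?m f g"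
      by (intro cube_modulus_Lipschitz) (simp_all add: ms)
    then show "?h k f \<le> ?h k g + 2 * mdist ?m f g"
      using mdist_nonneg[of ?m f g] by linarith
  qed
  have "(\<lambda>k. LINT v|N. ?h k (G v)) \<longlonglongrightarrow> (LINT v|N. 0)"
  proof (rule integral_dominated_convergence[where w = "\<lambda>_. 1"])
    show "(\<lambda>v. ?h k (G v)) \<in> borel_measurable N" for k
      by (rule measurable_compose[OF G continuous_map_measurable_metric_borel[OF cont_h]])
    show "AE v in N. norm (?h k (G v)) \<le> 1" for k
      using h01[OF GS] by (intro AE_I2) simp
    show "AE v in N. (\<lambda>k. ?h k (G v)) \<longlonglongrightarrow> 0"
      using cont
    proof (rule AE_mp, intro AE_I2 impI)
      fix v assume "v \<in> space N" "continuous_on unit_cube (G v)"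
      then have "(\<lambda>k. ?h k (G v)) \<longlonglongrightarrow> min 1 0"
        by (intro tendsto_min tendsto_const cube_modulus_tendsto_0 GS)
      then show "(\<lambda>k. ?h k (G v)) \<longlonglongrightarrow> 0" by simp
    qed
  qed auto
  then have "eventually (\<lambda>k. (LINT v|N. ?h k (G v)) < e) sequentially"
    using e by (intro order_tendstoD) auto
  then obtain k where k: "(LINT v|N. ?h k (G v)) < e"
    by (auto dest: eventually_happens)
  have "norm (?h k g) \<le> 1" if "g \<in> bounded_funs unit_cube" for g
    unfolding real_norm_def abs_le_iff using h01[OF that, of k] by linarith
  then have "bounded (?h k ` mspace ?m)"
    unfolding bounded_iff ms by blast
  then have "(\<lambda>n. outer_expectation M (\<lambda>\<omega>. ?h k (Z n \<omega>))) \<longlonglongrightarrow> (LINT v|N. ?h k (G v))"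
    using Z cont_h[of k] unfolding weakly_converges_def by blast
  then have "eventually (\<lambda>n. outer_expectation M (\<lambda>\<omega>. ?h k (Z n \<omega>)) < e) sequentially"
    using k by (rule order_tendstoD)
  then show thesis
    by (intro that[of "1 / real (Suc k)"]) auto
qed

text \<open>Three contributions of at most \<open>a / 3\<close> each: the modulus in outer
  expectation, and the deterministic Chebyshev term and bias uniformly over all samples.\<close>

lemma empirical_beta_copula_process_close:
  fixes C :: "real ^ 'd \<Rightarrow> real" and G :: "'v \<Rightarrow> real ^ 'd \<Rightarrow> real"
  assumes M: "prob_space M" and N: "prob_space N" and C: "is_copula C"
    and D: "\<And>j u. u \<in> unit_cube \<Longrightarrow> 0 < u $ j \<Longrightarrow> u $ j < 1 \<Longrightarrow> has_partial_derivative C j (C' j u) u"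
    and cont: "\<And>j. continuous_on {u \<in> unit_cube. 0 < u $ j \<and> u $ j < 1} (C' j)"
    and Z: "weakly_converges (linf unit_cube) M (\<lambda>n \<omega>. empirical_copula_process C n (x \<omega>)) N G"
    and G: "AE v in N. continuous_on unit_cube (G v)"
  shows "(\<lambda>n. outer_expectation M (\<lambda>\<omega>. min 1 (mdist (linf unit_cube)
    (empirical_beta_copula_process C n (x \<omega>)) (empirical_copula_process C n (x \<omega>))))) \<longlonglongrightarrow> 0"
    (is "(\<lambda>n. outer_expectation M (?T n)) \<longlonglongrightarrow> 0")
proof (rule order_tendstoI)
  interpret prob_space M by fact
  have T01: "0 \<le> ?T n \<omega>" "?T n \<omega> \<le> 1" for n \<omega>
    by auto
  show "eventually (\<lambda>n. a < outer_expectation M (?T n)) sequentially" if "a < 0" for a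
    using outer_expectation_nonneg[OF M T01] that by (intro always_eventually allI) (rule less_le_trans)
  fix a :: real assume a: "0 < a"
  obtain \<delta> where \<delta>: "0 < \<delta>" "eventually (\<lambda>n. outer_expectation M
      (\<lambda>\<omega>. min 1 (cube_modulus \<delta> (empirical_copula_process C n (x \<omega>)))) < a / 3) sequentially"
    using weakly_converges_cube_modulus_small[OF N Z G, of "a / 3"] a by auto
  have "(\<lambda>n. real CARD('d) / (2 * \<delta>\<^sup>2) * (1 / sqrt (real n))) \<longlonglongrightarrow> 0"
    by (rule tendsto_mult_right_zero) real_asymp
  then have "eventually (\<lambda>n. real CARD('d) / (2 * \<delta>\<^sup>2) * (1 / sqrt (real n)) < a / 3) sequentially"
    using a by (intro order_tendstoD) auto
  moreover have "eventually (\<lambda>n. \<forall>u\<in>unit_cube. \<bar>sqrt (real n) * (bernstein_avg n u C - C u)\<bar> \<le> a / 3) sequentially"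
    using copula_bernstein_bias[OF C D cont, of "a / 3"] a by simp
  ultimately show "eventually (\<lambda>n. outer_expectation M (?T n) < a) sequentially"
    using \<delta>(2) eventually_gt_at_top[of 0]
  proof eventually_elim
    case (elim n)
    let ?S = "\<lambda>\<omega>. min 1 (cube_modulus \<delta> (empirical_copula_process C n (x \<omega>)))"
    \<comment> \<open>The factor 1 plays the part of \<open>T2\<close> in
      \<open>outer_expectation_mono_add_scaled\<close>, with \<open>c\<close> equal to
      \<open>2 * a / 3\<close>.\<close>
    have le: "?T n \<omega> \<le> ?S \<omega> + (2 * a / 3) * 1" for \<omega>
    proof -
      have "mdist (linf unit_cube) (empirical_beta_copula_process C n (x \<omega>)) (empirical_copula_process C n (x \<omega>))
        \<le> cube_modulus \<delta> (empirical_copula_process C n (x \<omega>)) + real CARD('d) / (2 * \<delta>\<^sup>2) * (1 / sqrt (real n)) + a / 3"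
        by (rule empirical_beta_copula_process_diff[OF C elim(4) \<delta>(1)]) (use elim(2) in blast)
      with elim(1) a show ?thesis by linarith
    qed
    have "0 \<le> cube_modulus \<delta> (empirical_copula_process C n (x \<omega>))" for \<omega>
      using cube_modulus_nonneg[OF empirical_copula_process_in_bounded_funs[OF C]] \<delta>(1) by simp
    then have "outer_expectation M (?T n) \<le> outer_expectation M ?S + (2 * a / 3) * outer_expectation M (\<lambda>_. 1)"
      using a T01 by (intro outer_expectation_mono_add_scaled[OF M _ le, where B = 1 and ?B1.0 = 1 and ?B2.0 = 1]) auto
    also have "outer_expectation M (\<lambda>_. 1) \<le> 1"
      using outer_expectation_le_integral[OF M, of "\<lambda>_. 1" "\<lambda>_. 1" 1] by (simp add: prob_space)
    finally show ?case
      using elim(3) a by simp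
  qed
qed

theorem corollary3p7:
  fixes M :: "'w measure" and N :: "'v measure"
    and X :: "nat \<Rightarrow> 'w \<Rightarrow> real ^ 'd"
    and \<mu> :: "(real ^ 'd) measure"
    and C :: "real ^ 'd \<Rightarrow> real"
    and C' :: "'d \<Rightarrow> real ^ 'd \<Rightarrow> real"
    and G :: "'v \<Rightarrow> real ^ 'd \<Rightarrow> real"
  assumes "prob_space M" and "prob_space N"
    and "\<And>i. X i \<in> borel_measurable M"
    and "\<And>i. distr M borel (X i) = \<mu>"
    and "continuous_on UNIV (joint_cdf \<mu>)"
    and "is_copula_of C \<mu>"
    and "\<And>j u. u \<in> unit_cube \<Longrightarrow> 0 < u $ j \<Longrightarrow> u $ j < 1 \<Longrightarrow> has_partial_derivative C j (C' j u) u"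
    and "\<And>j. continuous_on {u \<in> unit_cube. 0 < u $ j \<and> u $ j < 1} (C' j)"
    and "weakly_converges (linf unit_cube) M
           (\<lambda>n \<omega>. empirical_copula_process C n (\<lambda>i. X i \<omega>)) N G"
    and "AE v in N. continuous_on unit_cube (G v)"
  shows "oP1 unit_cube M
           (\<lambda>n \<omega> u. empirical_beta_copula_process C n (\<lambda>i. X i \<omega>) u
                    - empirical_copula_process C n (\<lambda>i. X i \<omega>) u) \<and>
         weakly_converges (linf unit_cube) M
           (\<lambda>n \<omega>. empirical_beta_copula_process C n (\<lambda>i. X i \<omega>)) N G"
proof
  have C: "is_copula C"
    using assms(6) by (simp add: is_copula_of_def)
  let ?B = "\<lambda>n \<omega>. empirical_beta_copula_process C n (\<lambda>i. X i \<omega>)"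
  let ?E = "\<lambda>n \<omega>. empirical_copula_process C n (\<lambda>i. X i \<omega>)"
  let ?d = "\<lambda>n \<omega>. mdist (linf unit_cube) (?B n \<omega>) (?E n \<omega>)"
  note close = empirical_beta_copula_process_close[OF assms(1,2) C assms(7,8,9,10)]
  show "weakly_converges (linf unit_cube) M ?B N G"
    using assms(1,2,9) _ close
    by (rule weakly_converges_Slutsky)
      (simp add: mspace_linf[OF unit_cube_nonempty] empirical_beta_copula_process_in_bounded_funs[OF C])
  show "oP1 unit_cube M (\<lambda>n \<omega> u. ?B n \<omega> u - ?E n \<omega> u)"
    unfolding oP1_def
  proof (intro allI impI)
    fix \<epsilon> :: real assume "0 < \<epsilon>"
    \<comment> \<open>The truncated distance never exceeds 1, so the threshold is truncated as well
      before Markov's inequality is applied.\<close>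
    then have \<epsilon>: "0 < min 1 \<epsilon>" by simp
    have le: "outer_measure_of M {\<omega> \<in> space M. (SUP u\<in>unit_cube. \<bar>?B n \<omega> u - ?E n \<omega> u\<bar>) > \<epsilon>}
      \<le> ennreal (outer_expectation M (\<lambda>\<omega>. min 1 (?d n \<omega>)) / min 1 \<epsilon>)" for n
    proof -
      \<comment> \<open>Both processes are bounded on the cube, so the supremum in
        \<open>oP1\<close> is the distance in \<open>linf unit_cube\<close>.\<close>
      have "(SUP u\<in>unit_cube. \<bar>?B n \<omega> u - ?E n \<omega> u\<bar>) = ?d n \<omega>" for \<omega>
        by (simp add: mdist_linf[OF unit_cube_nonempty] empirical_beta_copula_process_in_bounded_funs[OF C]
            empirical_copula_process_in_bounded_funs[OF C])
      then have "outer_measure_of M {\<omega> \<in> space M. (SUP u\<in>unit_cube. \<bar>?B n \<omega> u - ?E n \<omega> u\<bar>) > \<epsilon>}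
        \<le> outer_measure_of M {\<omega> \<in> space M. min 1 \<epsilon> \<le> min 1 (?d n \<omega>)}"
        by (intro outer_measure_of_mono) auto
      also have "\<dots> \<le> ennreal (outer_expectation M (\<lambda>\<omega>. min 1 (?d n \<omega>)) / min 1 \<epsilon>)"
        by (rule outer_measure_of_le_outer_expectation[OF assms(1) \<epsilon>, where B = 1]) auto
      finally show ?thesis .
    qed
    have "(\<lambda>n. ennreal (outer_expectation M (\<lambda>\<omega>. min 1 (?d n \<omega>)) / min 1 \<epsilon>)) \<longlonglongrightarrow> ennreal (0 / min 1 \<epsilon>)"
      using \<epsilon> by (intro tendsto_ennrealI tendsto_divide close tendsto_const) auto
    then have lim: "(\<lambda>n. ennreal (outer_expectation M (\<lambda>\<omega>. min 1 (?d n \<omega>)) / min 1 \<epsilon>)) \<longlonglongrightarrow> 0"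
      by simp
    show "(\<lambda>n. outer_measure_of M {\<omega> \<in> space M. (SUP u\<in>unit_cube. \<bar>?B n \<omega> u - ?E n \<omega> u\<bar>) > \<epsilon>}) \<longlonglongrightarrow> 0"
      by (rule tendsto_sandwich[OF _ _ tendsto_const lim]) (use le in \<open>auto intro: always_eventually\<close>)
  qed
qed

end
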